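(* Let $F : \mathcal{C} \to \mathcal{E}$ be a functor that preserves pullbacks. Let $(g : b \to a,\ k : y \to x)$ be a map in $\mathrm{Gl}(F)$ from $\beta : b \to Fy$ to $\alpha : a \to Fx$ such that $g$, $k$ and $Fk$ are powerful. Then $(g,k)$ is powerful in $\mathrm{Gl}(F)$. Explicitly, for a map $(f : c \to b,\ h : z \to y)$ in $\mathrm{Gl}(F)$ from $\gamma : c \to Fz$ to $\beta$, the dependent product of $(f,h)$ along $(g,k)$ is the object $$\Pi_\beta\gamma \;:\; p \to a \times_{Fx} F(\Pi_y z) \to F(\Pi_y z)$$ over $\alpha$, where $p$ is the pullback over $a$ of $$a \times_{Fx} F(\Pi_y z) \xrightarrow{a \times_{Fx} F(\mathrm{ev})^\ddagger} a \times_{Fx} \Pi_{Fy}Fz \xrightarrow{(b \times_{Fy} \mathrm{ev})^\ddagger} \Pi_b(b \times_{Fy} Fz)$$ and $$\Pi_b c \xrightarrow{\Pi_b(f,\gamma)} \Pi_b(b \times_{Fy} Fz).$$ Further, for an object $\delta : d \to Fw$ over $\alpha$ in $\mathrm{Gl}(F)$, with structure map $(i : d \to a,\ j : w \to x)$, the bijection between maps $\delta \to \Pi_\beta\gamma$ over $\alpha$ and maps $\beta\times_\alpha\delta \to \gamma$ over $\beta$ is given as follows. A map $(u : d \to p,\ v : w \to \Pi_y z)$ is sent to $(u_2^\ddagger, v^\dagger)$, where $u_2 : d \to \Pi_b c$ is the composite of $u$ with the projection $p \to \Pi_b c$, $u_2^\ddagger : b \times_a d \to c$ is its transpose under $g^*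 \dashv \Pi_b$, and $v^\dagger : y \times_x w \to z$ is the transpose of $v$ under $k^* \dashv \Pi_y$. Conversely, $(\tilde u : b \times_a d \to c,\ \tilde v : y \times_x w \to z)$ is sent to $(u,v)$, where $v = \tilde v^\dagger : w \to \Pi_y z$ is the transpose of $\tilde v$, and $u : d \to p$ is the map induced by the map $\tilde u_1 : d \to a \times_{Fx} F(\Pi_y z)$ with components $i : d \to a$ and $F(\tilde v^\dagger) \circ \delta : d \to F(\Pi_y z)$, together with the transpose $\tilde u^\ddagger : d \to \Pi_b c$ of $\tilde u$. Moreover, the projection $\mathrm{Gl}(F) \to \mathcal{C}$ preserves the counit of the adjunction between pulling back along $(g,k)$ and the dependent product along $(g,k)$.
   Context: The *Artin gluing category* $\mathrm{Gl}(F)$ of $F : \mathcal{C} \to \mathcal{E}$ is the comma category $\mathcal{E} \downarrow F$: objects are maps $\alpha : a \to Fx$ in $\mathcal{E}$; a map from $\beta : b \to Fy$ to $\alpha : a \to Fx$ is a pair $(g : b \to a,\ k : y \to x)$ with $\alpha \circ g = Fk \circ \beta$. A map is *powerful* if pullback along it exists and the pullback functor between slices has a right adjoint; this right adjoint is called the dependent product. Write $\Pi_b$, $\Pi_y$, $\Pi_{Fy}$ for the right adjoints of $g^*$, $k^*$, $(Fk)^*$, and $\mathrm{ev}$ for the counits of these adjunctions. $\dagger$ and $\ddagger$ denote transposition (in either direction) under the relevant adjunction. In the claim: - $F(\mathrm{ev})^\ddagger : F(\Pi_y z) \to \Pi_{Fy}Fz$ over $Fx$ is the transpose under $(Fk)^*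 \dashv \Pi_{Fy}$ of $F(\Pi_y z) \times_{Fx} Fy \cong F(\Pi_y z \times_x y) \xrightarrow{F(\mathrm{ev})} Fz$; $a \times_{Fx} F(\mathrm{ev})^\ddagger$ is its pullback along $\alpha$. - $(b \times_{Fy} \mathrm{ev})^\ddagger : a \times_{Fx} \Pi_{Fy}Fz \to \Pi_b(b \times_{Fy} Fz)$ over $a$ is the transpose under $g^* \dashv \Pi_b$ of $b \times_{Fy} \mathrm{ev} : b \times_a (a \times_{Fx} \Pi_{Fy}Fz) \cong b \times_{Fy}(Fy \times_{Fx} \Pi_{Fy}Fz) \to b \times_{Fy} Fz$, the pullback along $\beta$ of the counit $\mathrm{ev} : Fy \times_{Fx} \Pi_{Fy}Fz \to Fz$. - $(f,\gamma) : c \to b \times_{Fy} Fz$ is the map induced by $f$ and $\gamma$. - $\beta \times_\alpha \delta$ is the pullback of $\delta$ along $(g,k)$, namely the componentwise pullback $b \times_a d \to Fy \times_{Fx} Fw \cong F(y \times_x w)$.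
   Formalization: The formal theorem additionally assumes that pullbacks along α and along β exist in E, and that the pullback p exists for each (f,h); without such pullbacks the displayed objects are undefined and the powerfulness claim can fail. *)

theory Defs
  imports Main
begin

section \<open>Categories, functors, adjunctions\<close>

record ('o, 'm) cat =
  Obj :: "'o set"
  Arr :: "'m set"
  Dom :: "'m \<Rightarrow> 'o"
  Cod :: "'m \<Rightarrow> 'o"
  Id :: "'o \<Rightarrow> 'm"
  Comp :: "'m \<Rightarrow> 'm \<Rightarrow> 'm"  (infixr "\<cdot>\<index>" 70)

definition hom :: "('o, 'm) cat \<Rightarrow> 'o \<Rightarrow> 'o \<Rightarrow> 'm set" where
  "hom C x y = {f \<in> Arr C. Dom C f = x \<and> Cod C f = y}"

definition category :: "('o, 'm) cat \<Rightarrow> bool" where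
  "category C \<longleftrightarrow>
    (\<forall>f \<in> Arr C. Dom C f \<in> Obj C \<and> Cod C f \<in> Obj C) \<and>
    (\<forall>x \<in> Obj C. Id C x \<in> hom C x x) \<and>
    (\<forall>f \<in> Arr C. \<forall>g \<in> Arr C. Dom C g = Cod C f \<longrightarrow> g \<cdot>\<^bsub>C\<^esub> f \<in> hom C (Dom C f) (Cod C g)) \<and>
    (\<forall>f \<in> Arr C. Id C (Cod C f) \<cdot>\<^bsub>C\<^esub> f = f \<and> f \<cdot>\<^bsub>C\<^esub> Id C (Dom C f) = f) \<and>
    (\<forall>f \<in> Arr C. \<forall>g \<in> Arr C. \<forall>h \<in> Arr C. Dom C g = Cod C f \<and> Dom C h = Cod C g \<longrightarrow>
      (h \<cdot>\<^bsub>C\<^esub> g) \<cdot>\<^bsub>C\<^esub> f = h \<cdot>\<^bsub>C\<^esub> (g \<cdot>\<^bsub>C\<^esub> f))"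

record ('o1, 'm1, 'o2, 'm2) fctr =
  fobj :: "'o1 \<Rightarrow> 'o2"
  farr :: "'m1 \<Rightarrow> 'm2"

definition is_functor ::
  "('o1, 'm1) cat \<Rightarrow> ('o2, 'm2) cat \<Rightarrow> ('o1, 'm1, 'o2, 'm2) fctr \<Rightarrow> bool" where
  "is_functor C D F \<longleftrightarrow>
    (\<forall>x \<in> Obj C. fobj F x \<in> Obj D \<and> farr F (Id C x) = Id D (fobj F x)) \<and>
    (\<forall>f \<in> Arr C. farr F f \<in> hom D (fobj F (Dom C f)) (fobj F (Cod C f))) \<and>
    (\<forall>f \<in> Arr C. \<forall>g \<in> Arr C. Dom C g = Cod C f \<longrightarrow>
      farr F (g \<cdot>\<^bsub>C\<^esub> f) = farr F g \<cdot>\<^bsub>D\<^esub> farr F f)"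

text \<open>
  \<open>adjunction A B L R \<phi>\<close>: the functor \<open>L : A \<rightarrow> B\<close> is left adjoint to \<open>R : B \<rightarrow> A\<close>, where
  \<open>\<phi> a b\<close> is the natural bijection from maps \<open>L a \<rightarrow> b\<close> to maps \<open>a \<rightarrow> R b\<close>.
\<close>

definition adjunction ::
  "('o1, 'm1) cat \<Rightarrow> ('o2, 'm2) cat \<Rightarrow> ('o1, 'm1, 'o2, 'm2) fctr \<Rightarrow> ('o2, 'm2, 'o1, 'm1) fctr
    \<Rightarrow> ('o1 \<Rightarrow> 'o2 \<Rightarrow> 'm2 \<Rightarrow> 'm1) \<Rightarrow> bool" where
  "adjunction A B L R \<phi> \<longleftrightarrow>
    is_functor A B L \<and> is_functor B A R \<and>
    (\<forall>a \<in> Obj A. \<forall>b \<in> Obj B. bij_betw (\<phi> a b) (hom B (fobj L a) b) (hom A a (fobj R b))) \<and>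
    (\<forall>s \<in> Arr A. \<forall>t \<in> Arr B. \<forall>f \<in> hom B (fobj L (Cod A s)) (Dom B t).
      \<phi> (Dom A s) (Cod B t) (t \<cdot>\<^bsub>B\<^esub> f \<cdot>\<^bsub>B\<^esub> farr L s) =
      farr R t \<cdot>\<^bsub>A\<^esub> \<phi> (Cod A s) (Dom B t) f \<cdot>\<^bsub>A\<^esub> s)"

definition counit ::
  "('o1, 'm1) cat \<Rightarrow> ('o2, 'm2) cat \<Rightarrow> ('o1, 'm1, 'o2, 'm2) fctr \<Rightarrow> ('o2, 'm2, 'o1, 'm1) fctr
    \<Rightarrow> ('o1 \<Rightarrow> 'o2 \<Rightarrow> 'm2 \<Rightarrow> 'm1) \<Rightarrow> 'o2 \<Rightarrow> 'm2" where
  "counit A B L R \<phi> b =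
    inv_into (hom B (fobj L (fobj R b)) b) (\<phi> (fobj R b) b) (Id A (fobj R b))"


section \<open>Slices, pullbacks, dependent products\<close>

text \<open>
  Morphisms of a slice remember their source and target, so that they have a well-defined domain
  and codomain; \<open>sarr\<close> is the underlying morphism.
\<close>

datatype 'm slar = SlAr (ssrc: 'm) (stgt: 'm) (sarr: 'm)

definition slice :: "('o, 'm) cat \<Rightarrow> 'o \<Rightarrow> ('m, 'm slar) cat" where
  "slice C x = \<lparr>
     Obj = {f \<in> Arr C. Cod C f = x},
     Arr = {SlAr f f' t | f f' t. f \<in> Arr C \<and> Cod C f = x \<and> f' \<in> Arr C \<and> Cod C f' = x \<and>
              t \<in> hom C (Dom C f) (Dom C f') \<and> f' \<cdot>\<^bsub>C\<^esub> t = f},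
     Dom = ssrc,
     Cod = stgt,
     Id = (\<lambda>f. SlAr f f (Id C (Dom C f))),
     Comp = (\<lambda>t s. SlAr (ssrc s) (stgt t) (sarr t \<cdot>\<^bsub>C\<^esub> sarr s)) \<rparr>"

definition is_pullback :: "('o, 'm) cat \<Rightarrow> 'm \<Rightarrow> 'm \<Rightarrow> 'm \<Rightarrow> 'm \<Rightarrow> bool" where
  "is_pullback C f g p q \<longleftrightarrow>
    f \<in> Arr C \<and> g \<in> Arr C \<and> p \<in> Arr C \<and> q \<in> Arr C \<and>
    Cod C f = Cod C g \<and> Dom C p = Dom C q \<and> Cod C p = Dom C f \<and> Cod C q = Dom C g \<and>
    f \<cdot>\<^bsub>C\<^esub> p = g \<cdot>\<^bsub>C\<^esub> q \<and>
    (\<forall>u \<in> Arr C. \<forall>v \<in> Arr C.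
      Dom C u = Dom C v \<and> Cod C u = Dom C f \<and> Cod C v = Dom C g \<and> f \<cdot>\<^bsub>C\<^esub> u = g \<cdot>\<^bsub>C\<^esub> v \<longrightarrow>
      (\<exists>!t. t \<in> hom C (Dom C u) (Dom C p) \<and> p \<cdot>\<^bsub>C\<^esub> t = u \<and> q \<cdot>\<^bsub>C\<^esub> t = v))"

text \<open>The map into a pullback with projections \<open>p\<close>, \<open>q\<close> induced by \<open>u\<close>, \<open>v\<close>.\<close>

definition induced :: "('o, 'm) cat \<Rightarrow> 'm \<Rightarrow> 'm \<Rightarrow> 'm \<Rightarrow> 'm \<Rightarrow> 'm" where
  "induced C p q u v =
    (THE t. t \<in> hom C (Dom C u) (Dom C p) \<and> p \<cdot>\<^bsub>C\<^esub> t = u \<and> q \<cdot>\<^bsub>C\<^esub> t = v)"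

definition preserves_pullbacks ::
  "('o1, 'm1) cat \<Rightarrow> ('o2, 'm2) cat \<Rightarrow> ('o1, 'm1, 'o2, 'm2) fctr \<Rightarrow> bool" where
  "preserves_pullbacks C D F \<longleftrightarrow>
    (\<forall>f g p q. is_pullback C f g p q \<longrightarrow>
      is_pullback D (farr F f) (farr F g) (farr F p) (farr F q))"

text \<open>
  A choice of pullbacks along \<open>g : b \<rightarrow> a\<close>: for \<open>f : d \<rightarrow> a\<close>, the projections are
  \<open>pb1 f : b \<times>\<^sub>a d \<rightarrow> b\<close> (the pulled back object of the slice over \<open>b\<close>) and \<open>pb2 f : b \<times>\<^sub>a d \<rightarrow> d\<close>.
\<close>

record 'm pbs =
  pb1 :: "'m \<Rightarrow> 'm"
  pb2 :: "'m \<Rightarrow> 'm"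

definition pullbacks_along :: "('o, 'm) cat \<Rightarrow> 'm \<Rightarrow> ('m, 'z) pbs_scheme \<Rightarrow> bool" where
  "pullbacks_along C g P \<longleftrightarrow>
    g \<in> Arr C \<and> (\<forall>f \<in> Arr C. Cod C f = Cod C g \<longrightarrow> is_pullback C g f (pb1 P f) (pb2 P f))"

definition pullback_functor ::
  "('o, 'm) cat \<Rightarrow> ('m, 'z) pbs_scheme \<Rightarrow> ('m, 'm slar, 'm, 'm slar) fctr" where
  "pullback_functor C P = \<lparr>
     fobj = pb1 P,
     farr = (\<lambda>s. SlAr (pb1 P (ssrc s)) (pb1 P (stgt s))
               (induced C (pb1 P (stgt s)) (pb2 P (stgt s))
                  (pb1 P (ssrc s)) (sarr s \<cdot>\<^bsub>C\<^esub> pb2 P (ssrc s)))) \<rparr>"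

text \<open>
  The data of dependent products along a map: chosen pullbacks, the functor \<open>DPi\<close> between slices,
  and the transposition bijections.
\<close>

record 'm dprods = "'m pbs" +
  DPi :: "('m, 'm slar, 'm, 'm slar) fctr"
  Tr :: "'m \<Rightarrow> 'm \<Rightarrow> 'm slar \<Rightarrow> 'm slar"

definition powerful_via :: "('o, 'm) cat \<Rightarrow> 'm \<Rightarrow> 'm dprods \<Rightarrow> bool" where
  "powerful_via C g D \<longleftrightarrow>
    pullbacks_along C g D \<and>
    adjunction (slice C (Cod C g)) (slice C (Dom C g)) (pullback_functor C D) (DPi D) (Tr D)"

definition powerful :: "('o, 'm) cat \<Rightarrow> 'm \<Rightarrow> bool" where
  "powerful C g \<longleftrightarrow> (\<exists>D. powerful_via C g D)"

definition ev :: "('o, 'm) cat \<Rightarrow> 'm \<Rightarrow> 'm dprods \<Rightarrow> 'm \<Rightarrow> 'm slar" where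
  "ev C g D =
    counit (slice C (Cod C g)) (slice C (Dom C g)) (pullback_functor C D) (DPi D) (Tr D)"

text \<open>
  Transposition in both directions, on underlying morphisms, between maps \<open>u : g\<^sup>* d \<rightarrow> c\<close> over the
  domain of \<open>g\<close> and maps \<open>v : d \<rightarrow> \<Pi> c\<close> over its codomain.
\<close>

definition adj_transp :: "'m dprods \<Rightarrow> 'm \<Rightarrow> 'm \<Rightarrow> 'm \<Rightarrow> 'm" where
  "adj_transp D d c u = sarr (Tr D d c (SlAr (pb1 D d) c u))"

definition adj_untransp :: "('o, 'm) cat \<Rightarrow> 'm \<Rightarrow> 'm dprods \<Rightarrow> 'm \<Rightarrow> 'm \<Rightarrow> 'm \<Rightarrow> 'm" where
  "adj_untransp C g D d c v =
    sarr (inv_into (hom (slice C (Dom C g)) (pb1 D d) c) (Tr D d c) (SlAr d (fobj (DPi D) c) v))"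


section \<open>Artin gluing\<close>

text \<open>
  An object \<open>\<alpha> : a \<rightarrow> F x\<close> is stored with \<open>x\<close>, which \<open>F x\<close> need not determine. As in slices,
  morphisms remember their source and target.
\<close>

datatype ('oC, 'mE) glob = GlOb (gmap: 'mE) (base: 'oC)

datatype ('oC, 'mC, 'mE) glar =
  GlAr (src: "('oC, 'mE) glob") (tgt: "('oC, 'mE) glob") (upper: 'mE) (lower: 'mC)

definition Gl ::
  "('oC, 'mC) cat \<Rightarrow> ('oE, 'mE) cat \<Rightarrow> ('oC, 'mC, 'oE, 'mE) fctr
    \<Rightarrow> (('oC, 'mE) glob, ('oC, 'mC, 'mE) glar) cat" where
  "Gl C E F =
    (let obs = {GlOb \<alpha> x | \<alpha> x. x \<in> Obj C \<and> \<alpha> \<in> Arr E \<and> Cod E \<alpha> = fobj F x} in \<lparr>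
     Obj = obs,
     Arr = {GlAr \<beta> \<alpha> g k | \<beta> \<alpha> g k. \<beta> \<in> obs \<and> \<alpha> \<in> obs \<and>
              g \<in> hom E (Dom E (gmap \<beta>)) (Dom E (gmap \<alpha>)) \<and> k \<in> hom C (base \<beta>) (base \<alpha>) \<and>
              gmap \<alpha> \<cdot>\<^bsub>E\<^esub> g = farr F k \<cdot>\<^bsub>E\<^esub> gmap \<beta>},
     Dom = src,
     Cod = tgt,
     Id = (\<lambda>\<alpha>. GlAr \<alpha> \<alpha> (Id E (Dom E (gmap \<alpha>))) (Id C (base \<alpha>))),
     Comp = (\<lambda>t s. GlAr (src s) (tgt t) (upper t \<cdot>\<^bsub>E\<^esub> upper s) (lower t \<cdot>\<^bsub>C\<^esub> lower s)) \<rparr>)"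

definition Gl_proj ::
  "(('oC, 'mE) glob, ('oC, 'mC, 'mE) glar, 'oC, 'mC) fctr" where
  "Gl_proj = \<lparr> fobj = base, farr = lower \<rparr>"


section \<open>Pullbacks and dependent products in the gluing category\<close>

text \<open>
  Throughout, \<open>m = (g, k)\<close> is a map from \<open>\<beta> : b \<rightarrow> F y\<close> to \<open>\<alpha> : a \<rightarrow> F x\<close>, with dependent products
  \<open>Dg\<close>, \<open>Dk\<close>, \<open>Dl\<close> along \<open>g\<close>, \<open>k\<close>, \<open>F k\<close>, and with pullbacks \<open>A\<close>, \<open>B\<close> along \<open>\<alpha>\<close>, \<open>\<beta>\<close>.
  These and the pullback \<open>p\<close> below are the only pullbacks whose existence is needed; the two
  categories need not have all pullbacks.
  First, for \<open>j : w \<rightarrow> x\<close>, the isomorphism from \<open>F y \<times>\<^bsub>F x\<^esub> F w\<close> to \<open>F (y \<times>\<^sub>x w)\<close>.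
\<close>

definition pb_iso ::
  "('oE, 'mE) cat \<Rightarrow> ('oC, 'mC, 'oE, 'mE) fctr \<Rightarrow> 'mC dprods \<Rightarrow> 'mE dprods \<Rightarrow> 'mC \<Rightarrow> 'mE" where
  "pb_iso E F Dk Dl j =
    induced E (farr F (pb1 Dk j)) (farr F (pb2 Dk j)) (pb1 Dl (farr F j)) (pb2 Dl (farr F j))"

text \<open>
  The object \<open>\<beta> \<times>\<^sub>\<alpha> \<delta>\<close> for an object \<open>d = (i, j) : \<delta> \<rightarrow> \<alpha>\<close> of the slice over \<open>\<alpha>\<close>, and its two
  projections.
\<close>

definition gl_pb ::
  "('oC, 'mC) cat \<Rightarrow> ('oE, 'mE) cat \<Rightarrow> ('oC, 'mC, 'oE, 'mE) fctr \<Rightarrow> ('oC, 'mC, 'mE) glar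
    \<Rightarrow> 'mE dprods \<Rightarrow> 'mC dprods \<Rightarrow> 'mE dprods
    \<Rightarrow> ('oC, 'mC, 'mE) glar \<Rightarrow> ('oC, 'mE) glob" where
  "gl_pb C E F m Dg Dk Dl d =
    GlOb
      (pb_iso E F Dk Dl (lower d) \<cdot>\<^bsub>E\<^esub>
       induced E (pb1 Dl (farr F (lower d))) (pb2 Dl (farr F (lower d)))
         (gmap (src m) \<cdot>\<^bsub>E\<^esub> pb1 Dg (upper d)) (gmap (src d) \<cdot>\<^bsub>E\<^esub> pb2 Dg (upper d)))
      (Dom C (pb1 Dk (lower d)))"

definition gl_pb1 ::
  "('oC, 'mC) cat \<Rightarrow> ('oE, 'mE) cat \<Rightarrow> ('oC, 'mC, 'oE, 'mE) fctr \<Rightarrow> ('oC, 'mC, 'mE) glar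
    \<Rightarrow> 'mE dprods \<Rightarrow> 'mC dprods \<Rightarrow> 'mE dprods
    \<Rightarrow> ('oC, 'mC, 'mE) glar \<Rightarrow> ('oC, 'mC, 'mE) glar" where
  "gl_pb1 C E F m Dg Dk Dl d =
    GlAr (gl_pb C E F m Dg Dk Dl d) (src m) (pb1 Dg (upper d)) (pb1 Dk (lower d))"

definition gl_pb2 ::
  "('oC, 'mC) cat \<Rightarrow> ('oE, 'mE) cat \<Rightarrow> ('oC, 'mC, 'oE, 'mE) fctr \<Rightarrow> ('oC, 'mC, 'mE) glar
    \<Rightarrow> 'mE dprods \<Rightarrow> 'mC dprods \<Rightarrow> 'mE dprods
    \<Rightarrow> ('oC, 'mC, 'mE) glar \<Rightarrow> ('oC, 'mC, 'mE) glar" where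
  "gl_pb2 C E F m Dg Dk Dl d =
    GlAr (gl_pb C E F m Dg Dk Dl d) (src d) (pb2 Dg (upper d)) (pb2 Dk (lower d))"

text \<open>\<open>F(ev)\<^sup>\<ddagger> : F (\<Pi>\<^sub>y z) \<rightarrow> \<Pi>\<^bsub>F y\<^esub> (F z)\<close> for \<open>h : z \<rightarrow> y\<close>.\<close>

definition F_ev ::
  "('oC, 'mC) cat \<Rightarrow> ('oE, 'mE) cat \<Rightarrow> ('oC, 'mC, 'oE, 'mE) fctr \<Rightarrow> ('oC, 'mC, 'mE) glar
    \<Rightarrow> 'mC dprods \<Rightarrow> 'mE dprods \<Rightarrow> 'mC \<Rightarrow> 'mE" where
  "F_ev C E F m Dk Dl h =
    (let \<pi> = fobj (DPi Dk) h in
     adj_transp Dl (farr F \<pi>) (farr F h)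
       (farr F (sarr (ev C (lower m) Dk h)) \<cdot>\<^bsub>E\<^esub> pb_iso E F Dk Dl \<pi>))"

text \<open>
  \<open>(b \<times>\<^bsub>F y\<^esub> ev)\<^sup>\<ddagger> : a \<times>\<^bsub>F x\<^esub> \<Pi>\<^bsub>F y\<^esub> (F z) \<rightarrow> \<Pi>\<^sub>b (b \<times>\<^bsub>F y\<^esub> F z)\<close> for \<open>h : z \<rightarrow> y\<close>; here \<open>assoc\<close> is the
  isomorphism from \<open>b \<times>\<^sub>a (a \<times>\<^bsub>F x\<^esub> \<Pi>\<^bsub>F y\<^esub> (F z))\<close> to \<open>b \<times>\<^bsub>F y\<^esub> (F y \<times>\<^bsub>F x\<^esub> \<Pi>\<^bsub>F y\<^esub> (F z))\<close>.
\<close>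

definition b_ev ::
  "('oE, 'mE) cat \<Rightarrow> ('oC, 'mC, 'oE, 'mE) fctr \<Rightarrow> ('oC, 'mC, 'mE) glar
    \<Rightarrow> 'mE dprods \<Rightarrow> 'mE dprods \<Rightarrow> 'mE pbs \<Rightarrow> 'mE pbs \<Rightarrow> 'mC \<Rightarrow> 'mE" where
  "b_ev E F m Dg Dl A B h =
    (let \<pi> = fobj (DPi Dl) (farr F h);
         d = pb1 A \<pi>;
         assoc = induced E (pb1 B (pb1 Dl \<pi>)) (pb2 B (pb1 Dl \<pi>))
                   (pb1 Dg d)
                   (induced E (pb1 Dl \<pi>) (pb2 Dl \<pi>)
                     (gmap (src m) \<cdot>\<^bsub>E\<^esub> pb1 Dg d) (pb2 A \<pi> \<cdot>\<^bsub>E\<^esub> pb2 Dg d))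
     in adj_transp Dg d (pb1 B (farr F h))
          (sarr (farr (pullback_functor E B) (ev E (farr F (lower m)) Dl (farr F h))) \<cdot>\<^bsub>E\<^esub> assoc))"

text \<open>
  The two maps into \<open>\<Pi>\<^sub>b (b \<times>\<^bsub>F y\<^esub> F z)\<close> whose pullback is \<open>p\<close>, for an object \<open>c = (f, h) : \<gamma> \<rightarrow> \<beta>\<close> of
  the slice over \<open>\<beta>\<close>: the composite of \<open>a \<times>\<^bsub>F x\<^esub> F(ev)\<^sup>\<ddagger>\<close> and \<open>(b \<times>\<^bsub>F y\<^esub> ev)\<^sup>\<ddagger>\<close>, and \<open>\<Pi>\<^sub>b (f, \<gamma>)\<close>.
\<close>

definition gl_leg1 ::
  "('oC, 'mC) cat \<Rightarrow> ('oE, 'mE) cat \<Rightarrow> ('oC, 'mC, 'oE, 'mE) fctr \<Rightarrow> ('oC, 'mC, 'mE) glar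
    \<Rightarrow> 'mE dprods \<Rightarrow> 'mC dprods \<Rightarrow> 'mE dprods \<Rightarrow> 'mE pbs \<Rightarrow> 'mE pbs
    \<Rightarrow> ('oC, 'mC, 'mE) glar \<Rightarrow> 'mE" where
  "gl_leg1 C E F m Dg Dk Dl A B c =
    b_ev E F m Dg Dl A B (lower c) \<cdot>\<^bsub>E\<^esub>
    sarr (farr (pullback_functor E A)
      (SlAr (farr F (fobj (DPi Dk) (lower c))) (fobj (DPi Dl) (farr F (lower c)))
        (F_ev C E F m Dk Dl (lower c))))"

definition gl_leg2 ::
  "('oE, 'mE) cat \<Rightarrow> ('oC, 'mC, 'oE, 'mE) fctr \<Rightarrow> 'mE dprods \<Rightarrow> 'mE pbs
    \<Rightarrow> ('oC, 'mC, 'mE) glar \<Rightarrow> 'mE" where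
  "gl_leg2 E F Dg B c =
    (let Fh = farr F (lower c) in
     sarr (farr (DPi Dg)
       (SlAr (upper c) (pb1 B Fh) (induced E (pb1 B Fh) (pb2 B Fh) (upper c) (gmap (src c))))))"

text \<open>
  \<open>\<Pi>\<^sub>\<beta> \<gamma>\<close> as an object of the slice over \<open>\<alpha>\<close>, where \<open>p1 c\<close> is the projection from \<open>p\<close> to
  \<open>a \<times>\<^bsub>F x\<^esub> F (\<Pi>\<^sub>y z)\<close>.
\<close>

definition gl_Pi ::
  "('oC, 'mC) cat \<Rightarrow> ('oE, 'mE) cat \<Rightarrow> ('oC, 'mC, 'oE, 'mE) fctr \<Rightarrow> ('oC, 'mC, 'mE) glar
    \<Rightarrow> 'mC dprods \<Rightarrow> 'mE pbs \<Rightarrow> (('oC, 'mC, 'mE) glar \<Rightarrow> 'mE)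
    \<Rightarrow> ('oC, 'mC, 'mE) glar \<Rightarrow> ('oC, 'mC, 'mE) glar" where
  "gl_Pi C E F m Dk A p1 c =
    (let \<pi> = fobj (DPi Dk) (lower c) in
     GlAr (GlOb (pb2 A (farr F \<pi>) \<cdot>\<^bsub>E\<^esub> p1 c) (Dom C \<pi>)) (tgt m)
       (pb1 A (farr F \<pi>) \<cdot>\<^bsub>E\<^esub> p1 c) \<pi>)"

end

theory Submission
  imports Defs
begin

text \<open>
  A map \<open>u : d \<rightarrow> p\<close> over \<open>a\<close> lying over \<open>v : w \<rightarrow> \<Pi>\<^sub>y z\<close> has its component
  \<open>d \<rightarrow> a \<times>\<^bsub>F x\<^esub> F (\<Pi>\<^sub>y z)\<close> forced to be \<open>(i, F v \<circ> \<delta>)\<close>, so it amounts to a map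
  \<open>u\<^sub>2 : d \<rightarrow> \<Pi>\<^sub>b c\<close> over \<open>a\<close> whose composite with \<open>\<Pi>\<^sub>b (f, \<gamma>)\<close> agrees with the image of
  \<open>(i, F v \<circ> \<delta>)\<close>. Transposing this equation of maps into \<open>\<Pi>\<^sub>b (b \<times>\<^bsub>F y\<^esub> F z)\<close> along
  \<open>g\<close>, its components at \<open>b\<close> agree automatically and its components at \<open>F z\<close> say that
  \<open>\<gamma> \<circ> u\<^sub>2' = F v' \<circ> (\<beta> \<times>\<^sub>\<alpha> \<delta>)\<close> for the transposes \<open>u\<^sub>2'\<close>, \<open>v'\<close>, which is exactly the condition
  for \<open>(u\<^sub>2', v')\<close> to be a map of \<open>Gl F\<close>. So transposition in the two components is the bijection
  sought.
\<close>

section \<open>Slices and pullback functors\<close>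

text \<open>Slice maps without the \<open>SlAr\<close> wrapper and without naming the base, so that
  computations take place on underlying morphisms. \<open>Arr_slice\<close> and
  \<open>hom_slice\<close> translate back; that both objects have the same base is derived in
  \<open>over_cod\<close>.\<close>

definition over :: "('o, 'm) cat \<Rightarrow> 'm \<Rightarrow> 'm \<Rightarrow> 'm \<Rightarrow> bool" where
  "over C f f' t \<longleftrightarrow> f \<in> Arr C \<and> f' \<in> Arr C \<and> t \<in> Arr C \<and>
     Dom C t = Dom C f \<and> Cod C t = Dom C f' \<and> f' \<cdot>\<^bsub>C\<^esub> t = f"

lemma overD:
  assumes "over C f f' t"
  shows "f \<in> Arr C" "f' \<in> Arr C" "t \<in> Arr C" "Dom C t = Dom C f" "Cod C t = Dom C f'"
    "f' \<cdot>\<^bsub>C\<^esub> t = f"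
  using assms by (auto simp: over_def)

lemma Obj_slice [simp]: "f \<in> Obj (slice C x) \<longleftrightarrow> f \<in> Arr C \<and> Cod C f = x"
  by (simp add: slice_def)

lemma slice_simps [simp]:
  "Dom (slice C x) = ssrc" "Cod (slice C x) = stgt"
  "Id (slice C x) f = SlAr f f (Id C (Dom C f))"
  "SlAr f' f'' t \<cdot>\<^bsub>slice C x\<^esub> SlAr f f''' s = SlAr f f'' (t \<cdot>\<^bsub>C\<^esub> s)"
  by (simp_all add: slice_def)

locale catg =
  fixes C :: "('o, 'm) cat" (structure)
  assumes category: "category C"
begin

lemma obj_dom_cod [simp]: "f \<in> Arr C \<Longrightarrow> Dom C f \<in> Obj C" "f \<in> Arr C \<Longrightarrow> Cod C f \<in> Obj C"
  using category by (auto simp: category_def)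

lemma id_arr [simp]:
  assumes "x \<in> Obj C"
  shows "Id C x \<in> Arr C" "Dom C (Id C x) = x" "Cod C (Id C x) = x"
  using assms category by (auto simp: category_def hom_def)

lemma comp_arr [simp]:
  assumes "f \<in> Arr C" "g \<in> Arr C" "Dom C g = Cod C f"
  shows "g \<cdot> f \<in> Arr C" "Dom C (g \<cdot> f) = Dom C f" "Cod C (g \<cdot> f) = Cod C g"
  using assms category by (auto simp: category_def hom_def)

lemma comp_id [simp]:
  "f \<in> Arr C \<Longrightarrow> Cod C f = y \<Longrightarrow> Id C y \<cdot> f = f"
  "f \<in> Arr C \<Longrightarrow> Dom C f = x \<Longrightarrow> f \<cdot> Id C x = f"
  using category by (auto simp: category_def)

lemma comp_assoc [simp]:
  "f \<in> Arr C \<Longrightarrow> g \<in> Arr C \<Longrightarrow> h \<in> Arr C \<Longrightarrow> Dom C g = Cod C f \<Longrightarrow> Dom C h = Cod C g \<Longrightarrow>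
    (h \<cdot> g) \<cdot> f = h \<cdot> (g \<cdot> f)"
  using category by (auto simp: category_def)

text \<open>Simplification brackets composites to the right, so a known equation for a two-fold
  composite no longer matches when something is precomposed. This form rewrites under such a
  precomposition.\<close>

lemma comp_assoc_eq:
  "k \<cdot> h = l \<Longrightarrow> f \<in> Arr C \<Longrightarrow> h \<in> Arr C \<Longrightarrow> k \<in> Arr C \<Longrightarrow> Dom C h = Cod C f \<Longrightarrow>
    Dom C k = Cod C h \<Longrightarrow> k \<cdot> (h \<cdot> f) = l \<cdot> f"
  by (metis comp_assoc)

lemma over_cod: "over C f f' t \<Longrightarrow> Cod C f = Cod C f'"
  by (auto simp: over_def)

lemma over_comp_assoc:
  assumes "over C f f' t" "x \<in> Arr C" "Cod C x = Dom C f"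
  shows "f' \<cdot> t \<cdot> x = f \<cdot> x"
  by (rule comp_assoc_eq) (use assms in \<open>auto simp: over_def\<close>)

lemma over_comp: "over C f f' t \<Longrightarrow> over C f' f'' t' \<Longrightarrow> over C f f'' (t' \<cdot> t)"
  using over_comp_assoc[of f' f'' t' t] by (auto simp: over_def)

lemma over_id: "f \<in> Arr C \<Longrightarrow> over C f f (Id C (Dom C f))"
  by (simp add: over_def)

lemma Arr_slice: "s \<in> Arr (slice C x) \<longleftrightarrow> over C (ssrc s) (stgt s) (sarr s) \<and> Cod C (stgt s) = x"
  by (cases s) (auto simp: slice_def over_def hom_def)

lemma hom_slice:
  "s \<in> hom (slice C x) f f' \<longleftrightarrow> s = SlAr f f' (sarr s) \<and> over C f f' (sarr s) \<and> Cod C f' = x"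
  by (cases s) (auto simp: hom_def Arr_slice)

lemma hom_slice_SlAr [simp]:
  "SlAr e e' t \<in> hom (slice C x) f f' \<longleftrightarrow> e = f \<and> e' = f' \<and> over C f f' t \<and> Cod C f' = x"
  by (auto simp: hom_slice)

lemma category_slice: "category (slice C x)"
proof -
  have "Id (slice C x) f \<in> hom (slice C x) f f" if "f \<in> Obj (slice C x)" for f
    using that by (simp add: over_id)
  moreover have "t \<cdot>\<^bsub>slice C x\<^esub> s \<in> hom (slice C x) (ssrc s) (stgt t)"
    if "s \<in> Arr (slice C x)" "t \<in> Arr (slice C x)" "ssrc t = stgt s" for s t
    using that by (cases s; cases t) (auto simp: Arr_slice intro: over_comp)
  moreover have "Id (slice C x) (stgt s) \<cdot>\<^bsub>slice C x\<^esub> s = s \<and> s \<cdot>\<^bsub>slice C x\<^esub> Id (slice C x) (ssrc s) = s"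
    if "s \<in> Arr (slice C x)" for s
    using that by (cases s) (auto simp: Arr_slice over_def)
  moreover have "(t \<cdot>\<^bsub>slice C x\<^esub> s) \<cdot>\<^bsub>slice C x\<^esub> r = t \<cdot>\<^bsub>slice C x\<^esub> (s \<cdot>\<^bsub>slice C x\<^esub> r)"
    if "r \<in> Arr (slice C x)" "s \<in> Arr (slice C x)" "t \<in> Arr (slice C x)"
      "ssrc s = stgt r" "ssrc t = stgt s" for r s t
    using that by (cases r; cases s; cases t) (auto simp: Arr_slice over_def)
  moreover have "ssrc s \<in> Obj (slice C x) \<and> stgt s \<in> Obj (slice C x)" if "s \<in> Arr (slice C x)" for s
    using that over_cod[of "ssrc s"] by (auto simp: Arr_slice over_def)
  ultimately show ?thesis
    unfolding category_def slice_simps by blast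
qed

section \<open>The universal property of a pullback\<close>

lemma pullback_arr:
  assumes "is_pullback C f g p q"
  shows "f \<in> Arr C" "g \<in> Arr C" "p \<in> Arr C" "q \<in> Arr C" "Cod C f = Cod C g"
    "Dom C p = Dom C q" "Cod C p = Dom C f" "Cod C q = Dom C g"
  using assms by (simp_all add: is_pullback_def)

lemma pullback_comp:
  assumes "is_pullback C f g p q" "t \<in> Arr C" "Cod C t = Dom C p"
  shows "f \<cdot> (p \<cdot> t) = g \<cdot> (q \<cdot> t)"
proof -
  have "f \<cdot> p = g \<cdot> q" using assms(1) by (simp add: is_pullback_def)
  then have "(f \<cdot> p) \<cdot> t = (g \<cdot> q) \<cdot> t" by simp
  then show ?thesis using assms(2,3) pullback_arr[OF assms(1)] by simp
qed

text \<open>Both \<open>s\<close> and \<open>t\<close> mediate the cone with components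
  \<open>p \<cdot> t\<close> and \<open>q \<cdot> t\<close>, and a mediating map is unique.\<close>

lemma pullback_unique:
  assumes "is_pullback C f g p q" "s \<in> Arr C" "t \<in> Arr C" "Dom C s = Dom C t"
    "Cod C s = Dom C p" "Cod C t = Dom C p" "p \<cdot> s = p \<cdot> t" "q \<cdot> s = q \<cdot> t"
  shows "s = t"
proof -
  have "\<exists>!r. r \<in> hom C (Dom C (p \<cdot> t)) (Dom C p) \<and> p \<cdot> r = p \<cdot> t \<and> q \<cdot> r = q \<cdot> t"
  proof -
    have "p \<cdot> t \<in> Arr C" "q \<cdot> t \<in> Arr C" "Dom C (p \<cdot> t) = Dom C (q \<cdot> t)"
      "Cod C (p \<cdot> t) = Dom C f" "Cod C (q \<cdot> t) = Dom C g" "f \<cdot> p \<cdot> t = g \<cdot> q \<cdot> t"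
      using assms pullback_arr[OF assms(1)] pullback_comp[OF assms(1,3,6)] by simp_all
    with assms(1) show ?thesis unfolding is_pullback_def by blast
  qed
  then show ?thesis
    using assms(2-) pullback_arr[OF assms(1)] by (auto simp: hom_def)
qed

lemma induced:
  assumes "is_pullback C f g p q" "u \<in> Arr C" "v \<in> Arr C" "Dom C u = Dom C v"
    "Cod C u = Dom C f" "Cod C v = Dom C g" "f \<cdot> u = g \<cdot> v"
  shows "induced C p q u v \<in> Arr C" "Dom C (induced C p q u v) = Dom C u"
    "Cod C (induced C p q u v) = Dom C p" "p \<cdot> induced C p q u v = u" "q \<cdot> induced C p q u v = v"
proof -
  have "\<exists>!t. t \<in> hom C (Dom C u) (Dom C p) \<and> p \<cdot> t = u \<and> q \<cdot> t = v"
    using assms unfolding is_pullback_def by blast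
  from theI'[OF this]
  show "induced C p q u v \<in> Arr C" "Dom C (induced C p q u v) = Dom C u"
    "Cod C (induced C p q u v) = Dom C p" "p \<cdot> induced C p q u v = u" "q \<cdot> induced C p q u v = v"
    by (auto simp: induced_def hom_def)
qed

text \<open>The cone is obtained by composing the projections with \<open>t\<close>, so it commutes
  automatically and no compatibility of \<open>u\<close> and \<open>v\<close> has to be assumed.
  Most values of \<open>induced\<close> below are identified this way.\<close>

lemma induced_eqI:
  assumes "is_pullback C f g p q" "t \<in> Arr C" "Cod C t = Dom C p" "p \<cdot> t = u" "q \<cdot> t = v"
  shows "induced C p q u v = t"
proof -
  note pb = pullback_arr[OF assms(1)]
  have "induced C p q (p \<cdot> t) (q \<cdot> t) = t"
    by (rule pullback_unique[OF assms(1)])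
      (use pb assms(2,3) pullback_comp[OF assms(1-3)] in \<open>simp_all add: induced[OF assms(1)]\<close>)
  then show ?thesis using assms by simp
qed

end

text \<open>The underlying morphism of the pullback functor applied to \<open>t\<close>, viewed as a
  map from \<open>f\<close> to \<open>f'\<close>.\<close>

definition pb_map :: "('o, 'm) cat \<Rightarrow> ('m, 'z) pbs_scheme \<Rightarrow> 'm \<Rightarrow> 'm \<Rightarrow> 'm \<Rightarrow> 'm" where
  "pb_map C P f f' t = induced C (pb1 P f') (pb2 P f') (pb1 P f) (t \<cdot>\<^bsub>C\<^esub> pb2 P f)"

lemma pullback_functor_simps [simp]:
  "fobj (pullback_functor C P) = pb1 P"
  "farr (pullback_functor C P) (SlAr f f' t) = SlAr (pb1 P f) (pb1 P f') (pb_map C P f f' t)"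
  by (simp_all add: pullback_functor_def pb_map_def)

section \<open>Pullback along a fixed map, as a functor between slices\<close>

locale pbs_along = catg C for C :: "('o, 'm) cat" (structure) +
  fixes g :: 'm and P :: "('m, 'z) pbs_scheme"
  assumes pullbacks: "pullbacks_along C g P"
begin

lemma base_arr [simp]: "g \<in> Arr C"
  using pullbacks by (simp add: pullbacks_along_def)

lemma pullback: "f \<in> Arr C \<Longrightarrow> Cod C f = Cod C g \<Longrightarrow> is_pullback C g f (pb1 P f) (pb2 P f)"
  using pullbacks by (simp add: pullbacks_along_def)

lemma pb_arr [simp]:
  assumes "f \<in> Arr C" "Cod C f = Cod C g"
  shows "pb1 P f \<in> Arr C" "pb2 P f \<in> Arr C" "Dom C (pb2 P f) = Dom C (pb1 P f)"
    "Cod C (pb1 P f) = Dom C g" "Cod C (pb2 P f) = Dom C f"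
  using pullback[OF assms] by (auto simp: is_pullback_def)

lemma pb_square:
  assumes "f \<in> Arr C" "Cod C f = Cod C g"
  shows "g \<cdot> pb1 P f = f \<cdot> pb2 P f"
  using pullback[OF assms] by (auto simp: is_pullback_def)

lemma pb_map:
  assumes "over C f f' t" "Cod C f' = Cod C g"
  shows "pb_map C P f f' t \<in> Arr C" "Dom C (pb_map C P f f' t) = Dom C (pb1 P f)"
    "Cod C (pb_map C P f f' t) = Dom C (pb1 P f')" "pb1 P f' \<cdot> pb_map C P f f' t = pb1 P f"
    "pb2 P f' \<cdot> pb_map C P f f' t = t \<cdot> pb2 P f"
proof -
  note o = overD[OF assms(1)] over_cod[OF assms(1)] assms(2)
  have "g \<cdot> pb1 P f = f' \<cdot> (t \<cdot> pb2 P f)"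
    using o pb_square[of f] by (simp add: over_comp_assoc[OF assms(1)])
  with induced[OF pullback[of f'], of "pb1 P f" "t \<cdot> pb2 P f"] o
  show "pb_map C P f f' t \<in> Arr C" "Dom C (pb_map C P f f' t) = Dom C (pb1 P f)"
    "Cod C (pb_map C P f f' t) = Dom C (pb1 P f')" "pb1 P f' \<cdot> pb_map C P f f' t = pb1 P f"
    "pb2 P f' \<cdot> pb_map C P f f' t = t \<cdot> pb2 P f"
    by (auto simp: pb_map_def)
qed

lemma pb_map_assoc:
  assumes "over C f f' t" "Cod C f' = Cod C g" "x \<in> Arr C" "Cod C x = Dom C (pb1 P f)"
  shows "pb1 P f' \<cdot> pb_map C P f f' t \<cdot> x = pb1 P f \<cdot> x"
    "pb2 P f' \<cdot> pb_map C P f f' t \<cdot> x = t \<cdot> pb2 P f \<cdot> x"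
proof -
  note o = overD[OF assms(1)] over_cod[OF assms(1)] assms(2-4) pb_map[OF assms(1,2)]
  show "pb1 P f' \<cdot> pb_map C P f f' t \<cdot> x = pb1 P f \<cdot> x"
    by (rule comp_assoc_eq) (use o in auto)
  have "pb2 P f' \<cdot> pb_map C P f f' t \<cdot> x = (t \<cdot> pb2 P f) \<cdot> x"
    by (rule comp_assoc_eq) (use o in auto)
  then show "pb2 P f' \<cdot> pb_map C P f f' t \<cdot> x = t \<cdot> pb2 P f \<cdot> x"
    using o by simp
qed

text \<open>A map into the pullback is determined by its two projections; functoriality and all
  later computations of \<open>pb_map\<close> rest on this.\<close>

lemma pb_map_eqI:
  assumes "f' \<in> Arr C" "Cod C f' = Cod C g" "s \<in> Arr C" "Cod C s = Dom C (pb1 P f')"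
    "pb1 P f' \<cdot> s = pb1 P f" "pb2 P f' \<cdot> s = t \<cdot> pb2 P f"
  shows "pb_map C P f f' t = s"
  unfolding pb_map_def using assms by (intro induced_eqI[OF pullback]) auto

lemma pb_map_over:
  assumes "over C f f' t" "Cod C f' = Cod C g"
  shows "over C (pb1 P f) (pb1 P f') (pb_map C P f f' t)"
  using pb_map[OF assms] overD[OF assms(1)] over_cod[OF assms(1)] assms(2) by (simp add: over_def)

lemma pb_map_comp:
  assumes "over C f f' t" "over C f' f'' t'" "Cod C f'' = Cod C g"
  shows "pb_map C P f f'' (t' \<cdot> t) = pb_map C P f' f'' t' \<cdot> pb_map C P f f' t"
proof -
  note c = overD[OF assms(1)] over_cod[OF assms(1)] overD[OF assms(2)] over_cod[OF assms(2)] assms(3)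
  note m = pb_map[OF assms(1)] pb_map[OF assms(2)]
  show ?thesis
    using c m pb_map_assoc[OF assms(2,3)] by (intro pb_map_eqI) auto
qed

lemma pullback_functor: "is_functor (slice C (Cod C g)) (slice C (Dom C g)) (pullback_functor C P)"
proof -
  have "pb_map C P f f (Id C (Dom C f)) = Id C (Dom C (pb1 P f))"
    if "f \<in> Arr C" "Cod C f = Cod C g" for f
    using that by (intro pb_map_eqI) auto
  moreover have "farr (pullback_functor C P) s
      \<in> hom (slice C (Dom C g)) (pb1 P (ssrc s)) (pb1 P (stgt s))"
    if "s \<in> Arr (slice C (Cod C g))" for s
    using that by (cases s) (auto simp: Arr_slice dest: overD intro: pb_map_over)
  moreover have "farr (pullback_functor C P) (t \<cdot>\<^bsub>slice C (Cod C g)\<^esub> s) =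
      farr (pullback_functor C P) t \<cdot>\<^bsub>slice C (Dom C g)\<^esub> farr (pullback_functor C P) s"
    if "s \<in> Arr (slice C (Cod C g))" "t \<in> Arr (slice C (Cod C g))" "ssrc t = stgt s" for s t
    using that by (cases s; cases t) (auto simp: Arr_slice pb_map_comp)
  ultimately show ?thesis
    unfolding is_functor_def by simp
qed

end


section \<open>Adjunctions\<close>

text \<open>Naturality in the second argument and functoriality of the right adjoint are automatic once
  its action on maps is defined by transposition.\<close>

lemma adjunction_from_representation:
  fixes A :: "('o1, 'm1) cat" and B :: "('o2, 'm2) cat"
  assumes A: "category A" and B: "category B" and L: "is_functor A B L"
    and r: "\<And>b. b \<in> Obj B \<Longrightarrow> r b \<in> Obj A"
    and bij: "\<And>a b. a \<in> Obj A \<Longrightarrow> b \<in> Obj B \<Longrightarrow>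
      bij_betw (\<phi> a b) (hom B (fobj L a) b) (hom A a (r b))"
    and nat: "\<And>s b f. s \<in> Arr A \<Longrightarrow> b \<in> Obj B \<Longrightarrow> f \<in> hom B (fobj L (Cod A s)) b \<Longrightarrow>
      \<phi> (Dom A s) b (f \<cdot>\<^bsub>B\<^esub> farr L s) = \<phi> (Cod A s) b f \<cdot>\<^bsub>A\<^esub> s"
  shows "\<exists>R. fobj R = r \<and> adjunction A B L R \<phi>"
proof -
  interpret A: catg A by standard fact
  interpret B: catg B by standard fact
  \<comment> \<open>The counit at \<open>b\<close>: the map whose transpose is the identity of
    \<open>r b\<close>.\<close>
  define e where "e b = inv_into (hom B (fobj L (r b)) b) (\<phi> (r b) b) (Id A (r b))" for b
  \<comment> \<open>A map \<open>t\<close> goes to the transpose of \<open>t\<close> after the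
    counit, the only choice compatible with naturality.\<close>
  define R where "R = \<lparr>fobj = r, farr = (\<lambda>t. \<phi> (r (Dom B t)) (Cod B t) (t \<cdot>\<^bsub>B\<^esub> e (Dom B t)))\<rparr>"
  have L': "fobj L a \<in> Obj B" "farr L (Id A a) = Id B (fobj L a)" if "a \<in> Obj A" for a
    using L that by (auto simp: is_functor_def)
  have L'': "farr L s \<in> Arr B" "Dom B (farr L s) = fobj L (Dom A s)"
    "Cod B (farr L s) = fobj L (Cod A s)" if "s \<in> Arr A" for s
    using L that by (auto simp: is_functor_def hom_def)
  have \<phi>: "\<phi> a b f \<in> Arr A" "Dom A (\<phi> a b f) = a" "Cod A (\<phi> a b f) = r b"
    if "a \<in> Obj A" "f \<in> Arr B" "Dom B f = fobj L a" "Cod B f = b" for a b f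
    using bij_betw_apply[OF bij[of a b], of f] that by (auto simp: hom_def)
  have e: "e b \<in> Arr B" "Dom B (e b) = fobj L (r b)" "Cod B (e b) = b"
    "\<phi> (r b) b (e b) = Id A (r b)" if "b \<in> Obj B" for b
  proof -
    have *: "Id A (r b) \<in> \<phi> (r b) b ` hom B (fobj L (r b)) b"
      using bij_betw_imp_surj_on[OF bij[of "r b" b]] that r[OF that] by (simp add: hom_def)
    show "e b \<in> Arr B" "Dom B (e b) = fobj L (r b)" "Cod B (e b) = b"
      using inv_into_into[OF *] by (auto simp: e_def hom_def)
    show "\<phi> (r b) b (e b) = Id A (r b)"
      using f_inv_into_f[OF *] by (simp add: e_def)
  qed
  \<comment> \<open>Recovering \<open>f\<close> from its transpose: by naturality in the first
    argument both sides have the same transpose, and \<open>\<phi> a b\<close> is injective.\<close>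
  have inv: "e b \<cdot>\<^bsub>B\<^esub> farr L (\<phi> a b f) = f"
    if "a \<in> Obj A" "f \<in> Arr B" "Dom B f = fobj L a" "Cod B f = b" for a b f
  proof -
    have b: "b \<in> Obj B" using that by auto
    have "\<phi> a b (e b \<cdot>\<^bsub>B\<^esub> farr L (\<phi> a b f)) = \<phi> a b f"
      using nat[of "\<phi> a b f" b "e b"] \<phi>[OF that] e[OF b] b by (simp add: hom_def)
    moreover have "e b \<cdot>\<^bsub>B\<^esub> farr L (\<phi> a b f) \<in> hom B (fobj L a) b" "f \<in> hom B (fobj L a) b"
      using \<phi>[OF that] e[OF b] L'' that by (auto simp: hom_def)
    ultimately show ?thesis
      using bij[OF that(1) b] by (auto simp: bij_betw_def inj_on_def)
  qed
  have R: "farr R t \<in> Arr A" "Dom A (farr R t) = r (Dom B t)" "Cod A (farr R t) = r (Cod B t)"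
    if "t \<in> Arr B" for t
    using that by (auto simp: R_def r \<phi> e)
  \<comment> \<open>Naturality in the second argument comes from the first: absorb the transpose of
    \<open>f\<close> into \<open>farr R t\<close> by \<open>nat\<close>, then cancel it against the
    counit by \<open>inv\<close>.\<close>
  have nat2: "\<phi> a (Cod B t) (t \<cdot>\<^bsub>B\<^esub> f) = farr R t \<cdot>\<^bsub>A\<^esub> \<phi> a (Dom B t) f"
    if "a \<in> Obj A" "t \<in> Arr B" "f \<in> Arr B" "Dom B f = fobj L a" "Cod B f = Dom B t" for a t f
  proof -
    note p = \<phi>[OF that(1,3-5)] inv[OF that(1,3-5)]
    have "farr R t \<cdot>\<^bsub>A\<^esub> \<phi> a (Dom B t) f
        = \<phi> a (Cod B t) ((t \<cdot>\<^bsub>B\<^esub> e (Dom B t)) \<cdot>\<^bsub>B\<^esub> farr L (\<phi> a (Dom B t) f))"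
      using nat[of "\<phi> a (Dom B t) f" "Cod B t" "t \<cdot>\<^bsub>B\<^esub> e (Dom B t)"] that p
      by (simp add: R_def hom_def e L'')
    also have "\<dots> = \<phi> a (Cod B t) (t \<cdot>\<^bsub>B\<^esub> f)"
      using that p by (simp add: e L'')
    finally show ?thesis ..
  qed
  have Rid: "farr R (Id B b) = Id A (r b)" if "b \<in> Obj B" for b
    using that by (simp add: R_def e)
  \<comment> \<open>Functoriality is \<open>nat2\<close> applied to \<open>s\<close> after the
    counit, whose transpose is \<open>farr R s\<close>.\<close>
  have Rcomp: "farr R (t \<cdot>\<^bsub>B\<^esub> s) = farr R t \<cdot>\<^bsub>A\<^esub> farr R s"
    if "s \<in> Arr B" "t \<in> Arr B" "Dom B t = Cod B s" for s t
  proof -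
    have "farr R (t \<cdot>\<^bsub>B\<^esub> s) = \<phi> (r (Dom B s)) (Cod B t) (t \<cdot>\<^bsub>B\<^esub> (s \<cdot>\<^bsub>B\<^esub> e (Dom B s)))"
      using that by (simp add: R_def e)
    also have "\<dots> = farr R t \<cdot>\<^bsub>A\<^esub> \<phi> (r (Dom B s)) (Dom B t) (s \<cdot>\<^bsub>B\<^esub> e (Dom B s))"
      using that by (intro nat2) (auto simp: e r)
    finally show ?thesis
      using that by (simp add: R_def)
  qed
  have "is_functor B A R"
    using R Rid Rcomp r by (simp add: is_functor_def hom_def R_def)
  moreover have "\<phi> (Dom A s) (Cod B t) (t \<cdot>\<^bsub>B\<^esub> f \<cdot>\<^bsub>B\<^esub> farr L s) =
      farr R t \<cdot>\<^bsub>A\<^esub> \<phi> (Cod A s) (Dom B t) f \<cdot>\<^bsub>A\<^esub> s"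
    if "s \<in> Arr A" "t \<in> Arr B" "f \<in> hom B (fobj L (Cod A s)) (Dom B t)" for s t f
    using that nat2[of "Dom A s" t "f \<cdot>\<^bsub>B\<^esub> farr L s"] nat[of s "Dom B t" f]
    by (simp add: hom_def L'')
  moreover have "fobj R = r" by (simp add: R_def)
  ultimately show ?thesis
    using L bij unfolding adjunction_def by (intro exI[of _ R]) simp
qed

lemma adjunction_natural:
  assumes "adjunction A B L R \<phi>" "s \<in> Arr A" "t \<in> Arr B" "f \<in> hom B (fobj L (Cod A s)) (Dom B t)"
  shows "\<phi> (Dom A s) (Cod B t) (t \<cdot>\<^bsub>B\<^esub> f \<cdot>\<^bsub>B\<^esub> farr L s) =
    farr R t \<cdot>\<^bsub>A\<^esub> \<phi> (Cod A s) (Dom B t) f \<cdot>\<^bsub>A\<^esub> s"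
  using assms by (auto simp: adjunction_def)

section \<open>Dependent products along a powerful map\<close>

locale dprods_along = catg C for C :: "('o, 'm) cat" (structure) +
  fixes g :: 'm and D :: "'m dprods"
  assumes powerful_via: "powerful_via C g D"

sublocale dprods_along \<subseteq> pbs_along C g D
  using powerful_via by unfold_locales (simp add: powerful_via_def)

context dprods_along
begin

abbreviation \<Pi> :: "'m \<Rightarrow> 'm" where "\<Pi> \<equiv> fobj (DPi D)"
abbreviation transp :: "'m \<Rightarrow> 'm \<Rightarrow> 'm \<Rightarrow> 'm" where "transp \<equiv> adj_transp D"
abbreviation untransp :: "'m \<Rightarrow> 'm \<Rightarrow> 'm \<Rightarrow> 'm" where "untransp \<equiv> adj_untransp C g D"

lemma adj: "adjunction (slice C (Cod C g)) (slice C (Dom C g)) (pullback_functor C D) (DPi D) (Tr D)"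
  using powerful_via by (simp add: powerful_via_def)

lemma Pi_arr [simp]:
  assumes "c \<in> Arr C" "Cod C c = Dom C g"
  shows "\<Pi> c \<in> Arr C" "Cod C (\<Pi> c) = Cod C g"
  using adj assms by (auto simp: adjunction_def is_functor_def)

lemma Pi_map_over:
  assumes "over C c c' t" "Cod C c' = Dom C g"
  shows "over C (\<Pi> c) (\<Pi> c') (sarr (farr (DPi D) (SlAr c c' t)))"
    "farr (DPi D) (SlAr c c' t) = SlAr (\<Pi> c) (\<Pi> c') (sarr (farr (DPi D) (SlAr c c' t)))"
proof -
  have "SlAr c c' t \<in> Arr (slice C (Dom C g))"
    using assms by (simp add: Arr_slice)
  then have "farr (DPi D) (SlAr c c' t) \<in> hom (slice C (Cod C g)) (\<Pi> c) (\<Pi> c')"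
    using adj by (auto simp: adjunction_def is_functor_def)
  then show "over C (\<Pi> c) (\<Pi> c') (sarr (farr (DPi D) (SlAr c c' t)))"
    "farr (DPi D) (SlAr c c' t) = SlAr (\<Pi> c) (\<Pi> c') (sarr (farr (DPi D) (SlAr c c' t)))"
    by (auto simp: hom_slice)
qed

lemma Tr_bij:
  assumes "d \<in> Arr C" "Cod C d = Cod C g" "c \<in> Arr C" "Cod C c = Dom C g"
  shows "bij_betw (Tr D d c) (hom (slice C (Dom C g)) (pb1 D d) c) (hom (slice C (Cod C g)) d (\<Pi> c))"
  using adj assms by (auto simp: adjunction_def)

lemma transp_over:
  assumes "over C (pb1 D d) c u" "d \<in> Arr C" "Cod C d = Cod C g"
  shows "over C d (\<Pi> c) (transp d c u)"
    "Tr D d c (SlAr (pb1 D d) c u) = SlAr d (\<Pi> c) (transp d c u)"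
proof -
  have "Cod C c = Dom C g"
    using assms over_cod[OF assms(1)] by simp
  then have "Tr D d c (SlAr (pb1 D d) c u) \<in> hom (slice C (Cod C g)) d (\<Pi> c)"
    using assms by (intro bij_betw_apply[OF Tr_bij]) (auto dest: overD)
  then show "over C d (\<Pi> c) (transp d c u)"
    "Tr D d c (SlAr (pb1 D d) c u) = SlAr d (\<Pi> c) (transp d c u)"
    by (auto simp: hom_slice adj_transp_def)
qed

lemma untransp_over:
  assumes "over C d (\<Pi> c) v" "c \<in> Arr C" "Cod C c = Dom C g"
  shows "over C (pb1 D d) c (untransp d c v)"
    "inv_into (hom (slice C (Dom C g)) (pb1 D d) c) (Tr D d c) (SlAr d (\<Pi> c) v)
      = SlAr (pb1 D d) c (untransp d c v)"
    "transp d c (untransp d c v) = v"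
proof -
  let ?H = "hom (slice C (Dom C g)) (pb1 D d) c"
  let ?t = "inv_into ?H (Tr D d c) (SlAr d (\<Pi> c) v)"
  have "Cod C d = Cod C g"
    using assms over_cod[OF assms(1)] by simp
  then have *: "SlAr d (\<Pi> c) v \<in> Tr D d c ` ?H"
    using bij_betw_imp_surj_on[OF Tr_bij[of d c]] assms overD[OF assms(1)] by simp
  from inv_into_into[OF *]
  show 1: "over C (pb1 D d) c (untransp d c v)" "?t = SlAr (pb1 D d) c (untransp d c v)"
    by (auto simp: hom_slice adj_untransp_def)
  from f_inv_into_f[OF *] show "transp d c (untransp d c v) = v"
    by (simp add: adj_transp_def flip: 1(2))
qed

lemma untransp_transp:
  assumes "over C (pb1 D d) c u" "d \<in> Arr C" "Cod C d = Cod C g"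
  shows "untransp d c (transp d c u) = u"
proof -
  have "Cod C c = Dom C g"
    using assms over_cod[OF assms(1)] by simp
  moreover have "SlAr (pb1 D d) c u \<in> hom (slice C (Dom C g)) (pb1 D d) c"
    using assms calculation by simp
  ultimately show ?thesis
    unfolding adj_untransp_def transp_over(2)[OF assms, symmetric]
    using Tr_bij[of d c] assms by (subst inv_into_f_f) (auto simp: bij_betw_def dest: overD)
qed

text \<open>The naturality clause of the adjunction, read on underlying morphisms. Taking
  \<open>t\<close> or \<open>s\<close> to be an identity gives the one-sided rules
  \<open>untransp_comp\<close> and \<open>untransp_Pi_map\<close>.\<close>

lemma transp_natural:
  assumes "over C (pb1 D d) c u" "over C d' d s" "over C c c' t" "Cod C d = Cod C g"
  shows "transp d' c' (t \<cdot> u \<cdot> pb_map C D d' d s)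
    = sarr (farr (DPi D) (SlAr c c' t)) \<cdot> transp d c u \<cdot> s"
proof -
  have d: "d \<in> Arr C" and c: "Cod C c' = Dom C g"
    using assms over_cod[OF assms(3)] over_cod[OF assms(1)] by (auto dest: overD)
  have "Tr D d' c' (SlAr c c' t \<cdot>\<^bsub>slice C (Dom C g)\<^esub> SlAr (pb1 D d) c u
        \<cdot>\<^bsub>slice C (Dom C g)\<^esub> farr (pullback_functor C D) (SlAr d' d s))
      = farr (DPi D) (SlAr c c' t) \<cdot>\<^bsub>slice C (Cod C g)\<^esub> Tr D d c (SlAr (pb1 D d) c u)
        \<cdot>\<^bsub>slice C (Cod C g)\<^esub> SlAr d' d s"
  proof -
    have "SlAr d' d s \<in> Arr (slice C (Cod C g))" "SlAr c c' t \<in> Arr (slice C (Dom C g))"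
      "SlAr (pb1 D d) c u \<in> hom (slice C (Dom C g)) (pb1 D d) c"
      using assms c over_cod[OF assms(3)] by (simp_all add: Arr_slice)
    with adjunction_natural[OF adj, of "SlAr d' d s" "SlAr c c' t" "SlAr (pb1 D d) c u"] show ?thesis
      by simp
  qed
  then show ?thesis
    unfolding transp_over(2)[OF assms(1) d assms(4)]
    by (subst (asm) Pi_map_over(2)[OF assms(3) c]) (simp add: adj_transp_def)
qed

lemma Pi_map_id:
  assumes "c \<in> Arr C" "Cod C c = Dom C g"
  shows "sarr (farr (DPi D) (SlAr c c (Id C (Dom C c)))) = Id C (Dom C (\<Pi> c))"
proof -
  have "c \<in> Obj (slice C (Dom C g))" using assms by simp
  then have "farr (DPi D) (Id (slice C (Dom C g)) c) = Id (slice C (Cod C g)) (\<Pi> c)"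
    using adj unfolding adjunction_def is_functor_def by blast
  then show ?thesis by simp
qed

text \<open>By naturality the right-hand side transposes to \<open>v \<cdot> s\<close>, and
  transposition is inverted by \<open>untransp\<close>.\<close>

lemma untransp_comp:
  assumes "over C d (\<Pi> c) v" "over C d' d s" "c \<in> Arr C" "Cod C c = Dom C g"
  shows "untransp d' c (v \<cdot> s) = untransp d c v \<cdot> pb_map C D d' d s"
proof -
  note u = untransp_over[OF assms(1,3,4)]
  have d: "Cod C d = Cod C g" "Cod C d' = Cod C g"
    using over_cod[OF assms(1)] over_cod[OF assms(2)] assms by auto
  have o: "over C (pb1 D d') c (untransp d c v \<cdot> pb_map C D d' d s)"
    using pb_map_over[OF assms(2) d(1)] u(1) over_comp by blast
  have "transp d' c (untransp d c v \<cdot> pb_map C D d' d s) = v \<cdot> s"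
    using transp_natural[OF u(1) assms(2) over_id[OF assms(3)] d(1)] Pi_map_id[OF assms(3,4)]
      overD[OF o] overD[OF u(1)] overD[OF assms(1)] overD[OF assms(2)] u(3)
      pb_map[OF assms(2) d(1)] by simp
  with untransp_transp[OF o _ d(2)] assms(2) show ?thesis
    by (auto dest: overD)
qed

text \<open>The counterpart of \<open>untransp_comp\<close> in the other variable, again by
  transposing the right-hand side.\<close>

lemma untransp_Pi_map:
  assumes "over C d (\<Pi> c) v" "over C c c' t" "Cod C c' = Dom C g"
  shows "untransp d c' (sarr (farr (DPi D) (SlAr c c' t)) \<cdot> v) = t \<cdot> untransp d c v"
proof -
  have c: "c \<in> Arr C" "Cod C c = Dom C g"
    using assms over_cod[OF assms(2)] by (auto dest: overD)
  note u = untransp_over[OF assms(1) c]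
  have d: "Cod C d = Cod C g" "d \<in> Arr C"
    using over_cod[OF assms(1)] overD[OF assms(1)] c by auto
  have o: "over C (pb1 D d) c' (t \<cdot> untransp d c v)"
    using over_comp[OF u(1) assms(2)] .
  have i: "pb_map C D d d (Id C (Dom C d)) = Id C (Dom C (pb1 D d))"
    using d by (intro pb_map_eqI) auto
  have "transp d c' (t \<cdot> untransp d c v) = sarr (farr (DPi D) (SlAr c c' t)) \<cdot> v"
    using transp_natural[OF u(1) over_id[OF d(2)] assms(2) d(1)] overD[OF u(1)] overD[OF assms(1)]
      u(3) d overD[OF assms(2)] by (simp add: i)
  with untransp_transp[OF o d(2,1)] show ?thesis
    by simp
qed

text \<open>Equality of maps into a dependent product may be tested after transposition; this is how
  the two legs are compared in \<open>legs_eq_iff\<close>.\<close>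

lemma untransp_eq_iff:
  assumes "over C d (\<Pi> c) v" "over C d (\<Pi> c) v'" "c \<in> Arr C" "Cod C c = Dom C g"
  shows "untransp d c v = untransp d c v' \<longleftrightarrow> v = v'"
  using untransp_over(3) assms by metis

text \<open>The inverse image of the identity in the definition of \<open>counit\<close> is a case
  of \<open>untransp\<close>, so the rules for \<open>untransp\<close> apply to the counit.\<close>

lemma ev_eq:
  assumes "c \<in> Arr C" "Cod C c = Dom C g"
  shows "ev C g D c = SlAr (pb1 D (\<Pi> c)) c (untransp (\<Pi> c) c (Id C (Dom C (\<Pi> c))))"
  using untransp_over(2)[OF over_id assms] assms by (simp add: ev_def counit_def)

lemma ev_over:
  assumes "c \<in> Arr C" "Cod C c = Dom C g"
  shows "over C (pb1 D (\<Pi> c)) c (sarr (ev C g D c))"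
  using untransp_over(1)[OF over_id assms] assms by (simp add: ev_eq)

text \<open>Naturality of \<open>untransp\<close> at an identity composed with \<open>v\<close>:
  untransposing is pulling back and then applying the counit.\<close>

lemma ev_pb_map:
  assumes "over C d (\<Pi> c) v" "c \<in> Arr C" "Cod C c = Dom C g"
  shows "sarr (ev C g D c) \<cdot> pb_map C D d (\<Pi> c) v = untransp d c v"
  using untransp_comp[OF over_id assms(1,2,3)] assms overD[OF assms(1)] by (simp add: ev_eq)

end

section \<open>The gluing category\<close>

text \<open>Membership in the object set of \<open>Gl\<close>, phrased through selectors rather than
  a constructor pattern, so that it simplifies for an abstract object.\<close>

definition is_glob :: "('oC, 'mC) cat \<Rightarrow> ('oE, 'mE) cat \<Rightarrow> ('oC, 'mC, 'oE, 'mE) fctr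
    \<Rightarrow> ('oC, 'mE) glob \<Rightarrow> bool" where
  "is_glob C E F \<alpha> \<longleftrightarrow> base \<alpha> \<in> Obj C \<and> gmap \<alpha> \<in> Arr E \<and> Cod E (gmap \<alpha>) = fobj F (base \<alpha>)"

lemma Gl_simps [simp]:
  "Dom (Gl C E F) = src" "Cod (Gl C E F) = tgt"
  "Id (Gl C E F) \<alpha> = GlAr \<alpha> \<alpha> (Id E (Dom E (gmap \<alpha>))) (Id C (base \<alpha>))"
  "t \<cdot>\<^bsub>Gl C E F\<^esub> s = GlAr (src s) (tgt t) (upper t \<cdot>\<^bsub>E\<^esub> upper s) (lower t \<cdot>\<^bsub>C\<^esub> lower s)"
  by (simp_all add: Gl_def Let_def)

lemma Obj_Gl: "\<alpha> \<in> Obj (Gl C E F) \<longleftrightarrow> is_glob C E F \<alpha>"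
  by (cases \<alpha>) (auto simp: Gl_def Let_def is_glob_def)

lemma Arr_Gl: "s \<in> Arr (Gl C E F) \<longleftrightarrow>
    is_glob C E F (src s) \<and> is_glob C E F (tgt s) \<and>
    upper s \<in> Arr E \<and> Dom E (upper s) = Dom E (gmap (src s)) \<and>
    Cod E (upper s) = Dom E (gmap (tgt s)) \<and>
    lower s \<in> Arr C \<and> Dom C (lower s) = base (src s) \<and> Cod C (lower s) = base (tgt s) \<and>
    gmap (tgt s) \<cdot>\<^bsub>E\<^esub> upper s = farr F (lower s) \<cdot>\<^bsub>E\<^esub> gmap (src s)"
proof -
  have "\<alpha> \<in> {GlOb \<alpha> x |\<alpha> x. x \<in> Obj C \<and> \<alpha> \<in> Arr E \<and> Cod E \<alpha> = fobj F x} \<longleftrightarrow> is_glob C E F \<alpha>" for \<alpha>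
    by (cases \<alpha>) (auto simp: is_glob_def)
  then show ?thesis
    by (cases s) (auto simp: Gl_def Let_def hom_def)
qed

locale gluing = C: catg C + E: catg E
  for C :: "('oC, 'mC) cat" and E :: "('oE, 'mE) cat" +
  fixes F :: "('oC, 'mC, 'oE, 'mE) fctr"
  assumes is_functor: "is_functor C E F"
begin

abbreviation compE :: "'mE \<Rightarrow> 'mE \<Rightarrow> 'mE" (infixr "\<bullet>" 70) where "g \<bullet> f \<equiv> g \<cdot>\<^bsub>E\<^esub> f"
abbreviation compC :: "'mC \<Rightarrow> 'mC \<Rightarrow> 'mC" (infixr "\<odot>" 70) where "g \<odot> f \<equiv> g \<cdot>\<^bsub>C\<^esub> f"

lemma F_simps [simp]:
  "x \<in> Obj C \<Longrightarrow> farr F (Id C x) = Id E (fobj F x)"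
  "f \<in> Arr C \<Longrightarrow> farr F f \<in> Arr E"
  "f \<in> Arr C \<Longrightarrow> Dom E (farr F f) = fobj F (Dom C f)"
  "f \<in> Arr C \<Longrightarrow> Cod E (farr F f) = fobj F (Cod C f)"
  "f \<in> Arr C \<Longrightarrow> g \<in> Arr C \<Longrightarrow> Dom C g = Cod C f \<Longrightarrow> farr F (g \<odot> f) = farr F g \<bullet> farr F f"
  using is_functor by (auto simp: is_functor_def hom_def)

lemma F_over: "over C f f' t \<Longrightarrow> over E (farr F f) (farr F f') (farr F t)"
  by (auto simp: over_def simp flip: F_simps(5))

lemma is_globD [simp]:
  assumes "is_glob C E F \<alpha>"
  shows "base \<alpha> \<in> Obj C" "gmap \<alpha> \<in> Arr E" "Cod E (gmap \<alpha>) = fobj F (base \<alpha>)"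
  using assms by (auto simp: is_glob_def)

lemma Gl_arrD:
  assumes "s \<in> Arr (Gl C E F)"
  shows "is_glob C E F (src s)" "is_glob C E F (tgt s)"
    "upper s \<in> Arr E" "Dom E (upper s) = Dom E (gmap (src s))" "Cod E (upper s) = Dom E (gmap (tgt s))"
    "lower s \<in> Arr C" "Dom C (lower s) = base (src s)" "Cod C (lower s) = base (tgt s)"
    "gmap (tgt s) \<bullet> upper s = farr F (lower s) \<bullet> gmap (src s)"
  using assms by (auto simp: Arr_Gl)

text \<open>Two commuting squares paste, and \<open>F\<close> carries the composite of the lower
  maps to the composite of their images.\<close>

lemma Gl_comp:
  assumes "s \<in> Arr (Gl C E F)" "t \<in> Arr (Gl C E F)" "src t = tgt s"
  shows "t \<cdot>\<^bsub>Gl C E F\<^esub> s \<in> Arr (Gl C E F)"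
proof -
  note s = Gl_arrD[OF assms(1)] and t = Gl_arrD[OF assms(2)]
  have "gmap (tgt t) \<bullet> (upper t \<bullet> upper s) = (farr F (lower t) \<bullet> gmap (src t)) \<bullet> upper s"
    by (rule E.comp_assoc_eq) (use s t assms(3) in auto)
  also have "\<dots> = (farr F (lower t) \<bullet> farr F (lower s)) \<bullet> gmap (src s)"
    using s t assms(3) by simp
  finally show ?thesis
    using s t assms(3) by (auto simp: Arr_Gl)
qed

lemma category_Gl: "category (Gl C E F)"
proof -
  have "Id (Gl C E F) \<alpha> \<in> hom (Gl C E F) \<alpha> \<alpha>" if "is_glob C E F \<alpha>" for \<alpha>
    using that by (simp add: hom_def Arr_Gl)
  moreover have "Id (Gl C E F) (tgt s) \<cdot>\<^bsub>Gl C E F\<^esub> s = s \<and> s \<cdot>\<^bsub>Gl C E F\<^esub> Id (Gl C E F) (src s) = s"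
    if "s \<in> Arr (Gl C E F)" for s
    using Gl_arrD[OF that] by (cases s) auto
  moreover have "(t \<cdot>\<^bsub>Gl C E F\<^esub> s) \<cdot>\<^bsub>Gl C E F\<^esub> r = t \<cdot>\<^bsub>Gl C E F\<^esub> (s \<cdot>\<^bsub>Gl C E F\<^esub> r)"
    if "r \<in> Arr (Gl C E F)" "s \<in> Arr (Gl C E F)" "t \<in> Arr (Gl C E F)" "src s = tgt r" "src t = tgt s"
    for r s t
    using Gl_arrD[OF that(1)] Gl_arrD[OF that(2)] Gl_arrD[OF that(3)] that by simp
  ultimately show ?thesis
    unfolding category_def
    using Gl_comp Gl_arrD(1,2) by (simp add: Obj_Gl hom_def)
qed

sublocale Gl: catg "Gl C E F"
  by standard (rule category_Gl)

text \<open>Composition in \<open>Gl\<close> is componentwise, so a commuting triangle there is a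
  pair of triangles, one in each category. This lets the rules for slices be applied separately to
  \<open>upper\<close> and \<open>lower\<close>.\<close>

lemma over_Gl: "over (Gl C E F) d d' s \<longleftrightarrow>
    d \<in> Arr (Gl C E F) \<and> d' \<in> Arr (Gl C E F) \<and> s \<in> Arr (Gl C E F) \<and>
    src s = src d \<and> tgt s = src d' \<and> tgt d' = tgt d \<and>
    over E (upper d) (upper d') (upper s) \<and> over C (lower d) (lower d') (lower s)"
proof -
  \<comment> \<open>Maps of \<open>Gl\<close> carry their ends, so the triangle equation also
    compares sources and targets.\<close>
  have "glar.GlAr (src s) (tgt d') t l = d \<longleftrightarrow> src s = src d \<and> tgt d' = tgt d \<and> t = upper d \<and> l = lower d"
    for t l by (cases d) auto
  then show ?thesis
    by (auto simp: over_def Gl_arrD(3-8))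
qed

end

section \<open>Componentwise pullbacks in the gluing category\<close>

locale gluing_map = gluing C E F
  + Dg: dprods_along E g Dg + Dk: dprods_along C k Dk + Dl: dprods_along E "farr F k" Dl
  + A: pbs_along E "gmap \<alpha>" A + B: pbs_along E "gmap \<beta>" B
  for C :: "('oC, 'mC) cat" and E :: "('oE, 'mE) cat" and F :: "('oC, 'mC, 'oE, 'mE) fctr"
    and g :: 'mE and k :: 'mC and \<alpha> \<beta> :: "('oC, 'mE) glob"
    and Dg Dl :: "'mE dprods" and Dk :: "'mC dprods" and A B :: "'mE pbs" +
  fixes m :: "('oC, 'mC, 'mE) glar"
  assumes preserves: "preserves_pullbacks C E F"
    and m_eq: "m = GlAr \<beta> \<alpha> g k" and m_arr: "m \<in> Arr (Gl C E F)"
begin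

lemma m_simps [simp]: "src m = \<beta>" "tgt m = \<alpha>" "upper m = g" "lower m = k"
  by (simp_all add: m_eq)

lemma map_ends [simp]:
  "is_glob C E F \<beta>" "is_glob C E F \<alpha>" "Dom E g = Dom E (gmap \<beta>)" "Cod E g = Dom E (gmap \<alpha>)"
  "Dom C k = base \<beta>" "Cod C k = base \<alpha>"
  using Gl_arrD[OF m_arr] by auto

lemma m_square: "gmap \<alpha> \<bullet> g = farr F k \<bullet> gmap \<beta>"
  using Gl_arrD(9)[OF m_arr] by simp

text \<open>The one place where preservation of pullbacks is invoked: maps into the image of a
  pullback along \<open>k\<close> may be built and compared through its two projections.\<close>

lemma F_pullback:
  assumes "j \<in> Arr C" "Cod C j = base \<alpha>"
  shows "is_pullback E (farr F k) (farr F j) (farr F (pb1 Dk j)) (farr F (pb2 Dk j))"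
  using preserves Dk.pullback[of j] assms by (simp add: preserves_pullbacks_def)

abbreviation iso :: "'mC \<Rightarrow> 'mE" where "iso \<equiv> pb_iso E F Dk Dl"
abbreviation gpb :: "('oC, 'mC, 'mE) glar \<Rightarrow> ('oC, 'mE) glob" where "gpb \<equiv> gl_pb C E F m Dg Dk Dl"
abbreviation gpb1 :: "('oC, 'mC, 'mE) glar \<Rightarrow> ('oC, 'mC, 'mE) glar" where
  "gpb1 \<equiv> gl_pb1 C E F m Dg Dk Dl"
abbreviation gpb2 :: "('oC, 'mC, 'mE) glar \<Rightarrow> ('oC, 'mC, 'mE) glar" where
  "gpb2 \<equiv> gl_pb2 C E F m Dg Dk Dl"

text \<open>The componentwise comparison from the pullback along \<open>g\<close> to the pullback
  along \<open>farr F k\<close>; followed by \<open>iso\<close> it is the structure map of the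
  pulled back object.\<close>

definition cmp :: "('oC, 'mC, 'mE) glar \<Rightarrow> 'mE" where
  "cmp d = induced E (pb1 Dl (farr F (lower d))) (pb2 Dl (farr F (lower d)))
     (gmap \<beta> \<bullet> pb1 Dg (upper d)) (gmap (src d) \<bullet> pb2 Dg (upper d))"

lemma iso:
  assumes "j \<in> Arr C" "Cod C j = base \<alpha>"
  shows "iso j \<in> Arr E" "Dom E (iso j) = Dom E (pb1 Dl (farr F j))"
    "Cod E (iso j) = fobj F (Dom C (pb1 Dk j))"
    "farr F (pb1 Dk j) \<bullet> iso j = pb1 Dl (farr F j)" "farr F (pb2 Dk j) \<bullet> iso j = pb2 Dl (farr F j)"
  unfolding pb_iso_def
  by (subst E.induced[OF F_pullback[OF assms]]; simp add: assms Dl.pb_square)+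

text \<open>The defining cone commutes by chasing the square of \<open>m\<close>, the pullback
  square along \<open>g\<close> and the square of \<open>d\<close>.\<close>

lemma cmp:
  assumes "d \<in> Arr (Gl C E F)" "tgt d = \<alpha>"
  shows "cmp d \<in> Arr E" "Dom E (cmp d) = Dom E (pb1 Dg (upper d))"
    "Cod E (cmp d) = Dom E (pb1 Dl (farr F (lower d)))"
    "pb1 Dl (farr F (lower d)) \<bullet> cmp d = gmap \<beta> \<bullet> pb1 Dg (upper d)"
    "pb2 Dl (farr F (lower d)) \<bullet> cmp d = gmap (src d) \<bullet> pb2 Dg (upper d)"
proof -
  note d = Gl_arrD[OF assms(1), unfolded assms(2)]
  have "farr F k \<bullet> (gmap \<beta> \<bullet> pb1 Dg (upper d)) = gmap \<alpha> \<bullet> g \<bullet> pb1 Dg (upper d)"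
    by (subst E.comp_assoc_eq[OF m_square]) (simp_all add: d)
  also have "\<dots> = farr F (lower d) \<bullet> (gmap (src d) \<bullet> pb2 Dg (upper d))"
    by (simp add: d(1-8) Dg.pb_square, subst E.comp_assoc_eq[OF d(9)]) (simp_all add: d(1-8))
  finally have "farr F k \<bullet> (gmap \<beta> \<bullet> pb1 Dg (upper d)) =
    farr F (lower d) \<bullet> (gmap (src d) \<bullet> pb2 Dg (upper d))" .
  note sq = this
  have j: "farr F (lower d) \<in> Arr E" "Cod E (farr F (lower d)) = Cod E (farr F k)"
    using d by simp_all
  show "cmp d \<in> Arr E" "Dom E (cmp d) = Dom E (pb1 Dg (upper d))"
    "Cod E (cmp d) = Dom E (pb1 Dl (farr F (lower d)))"
    "pb1 Dl (farr F (lower d)) \<bullet> cmp d = gmap \<beta> \<bullet> pb1 Dg (upper d)"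
    "pb2 Dl (farr F (lower d)) \<bullet> cmp d = gmap (src d) \<bullet> pb2 Dg (upper d)"
    unfolding cmp_def
    by (subst E.induced[OF Dl.pullback[OF j] _ _ _ _ _ sq]; simp add: d)+
qed

lemma gpb_eq: "gpb d = GlOb (iso (lower d) \<bullet> cmp d) (Dom C (pb1 Dk (lower d)))"
  by (simp add: gl_pb_def cmp_def)

lemma gpb_simps [simp]:
  "base (gpb d) = Dom C (pb1 Dk (lower d))"
  "src (gpb1 d) = gpb d" "tgt (gpb1 d) = \<beta>" "upper (gpb1 d) = pb1 Dg (upper d)"
  "lower (gpb1 d) = pb1 Dk (lower d)"
  "src (gpb2 d) = gpb d" "tgt (gpb2 d) = src d" "upper (gpb2 d) = pb2 Dg (upper d)"
  "lower (gpb2 d) = pb2 Dk (lower d)"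
  by (simp_all add: gpb_eq gl_pb1_def gl_pb2_def)

text \<open>The two projection equations are exactly the square conditions making
  \<open>gpb1 d\<close> and \<open>gpb2 d\<close> maps of \<open>Gl\<close>. They also determine
  \<open>gmap (gpb d)\<close>, by \<open>F_pullback\<close>.\<close>

lemma gpb:
  assumes "d \<in> Arr (Gl C E F)" "tgt d = \<alpha>"
  shows "gmap (gpb d) \<in> Arr E" "Dom E (gmap (gpb d)) = Dom E (pb1 Dg (upper d))"
    "Cod E (gmap (gpb d)) = fobj F (Dom C (pb1 Dk (lower d)))"
    "farr F (pb1 Dk (lower d)) \<bullet> gmap (gpb d) = gmap \<beta> \<bullet> pb1 Dg (upper d)"
    "farr F (pb2 Dk (lower d)) \<bullet> gmap (gpb d) = gmap (src d) \<bullet> pb2 Dg (upper d)"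
    "is_glob C E F (gpb d)"
proof -
  note d = Gl_arrD[OF assms(1), unfolded assms(2)]
  note i = iso[OF d(6,8)] and c = cmp[OF assms]
  note ic = E.comp_assoc_eq[OF i(4)] E.comp_assoc_eq[OF i(5)]
  show "gmap (gpb d) \<in> Arr E" "Dom E (gmap (gpb d)) = Dom E (pb1 Dg (upper d))"
    "Cod E (gmap (gpb d)) = fobj F (Dom C (pb1 Dk (lower d)))"
    "farr F (pb1 Dk (lower d)) \<bullet> gmap (gpb d) = gmap \<beta> \<bullet> pb1 Dg (upper d)"
    "farr F (pb2 Dk (lower d)) \<bullet> gmap (gpb d) = gmap (src d) \<bullet> pb2 Dg (upper d)"
    "is_glob C E F (gpb d)"
    by (simp_all add: gpb_eq d i c ic is_glob_def[of C E F "GlOb x y" for x y])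
qed

lemma gpb_arr:
  assumes "d \<in> Arr (Gl C E F)" "tgt d = \<alpha>"
  shows "gpb1 d \<in> Arr (Gl C E F)" "gpb2 d \<in> Arr (Gl C E F)"
  using Gl_arrD[OF assms(1), unfolded assms(2)] gpb[OF assms] by (simp_all add: Arr_Gl)

text \<open>The mediating map is the pair of mediating maps in \<open>E\<close> and
  \<open>C\<close>, and uniqueness is inherited from the components. What remains is that this pair
  satisfies the square condition of \<open>Gl\<close>.\<close>

lemma gpb_pullback:
  assumes "d \<in> Arr (Gl C E F)" "tgt d = \<alpha>"
  shows "is_pullback (Gl C E F) m d (gpb1 d) (gpb2 d)"
proof -
  note d = Gl_arrD[OF assms(1), unfolded assms(2)]
  note p = gpb[OF assms]
  have sq: "m \<cdot>\<^bsub>Gl C E F\<^esub> gpb1 d = d \<cdot>\<^bsub>Gl C E F\<^esub> gpb2 d"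
    using d assms by (simp add: Dg.pb_square Dk.pb_square)
  have "\<exists>!t. t \<in> hom (Gl C E F) (src u) (gpb d) \<and> gpb1 d \<cdot>\<^bsub>Gl C E F\<^esub> t = u \<and> gpb2 d \<cdot>\<^bsub>Gl C E F\<^esub> t = v"
    if u: "u \<in> Arr (Gl C E F)" and v: "v \<in> Arr (Gl C E F)" and uv: "src u = src v" "tgt u = \<beta>"
      "tgt v = src d" and e: "m \<cdot>\<^bsub>Gl C E F\<^esub> u = d \<cdot>\<^bsub>Gl C E F\<^esub> v" for u v
  proof -
    note u' = Gl_arrD[OF u, unfolded uv] and v' = Gl_arrD[OF v, unfolded uv]
    have e': "g \<bullet> upper u = upper d \<bullet> upper v" "k \<odot> lower u = lower d \<odot> lower v"
      using arg_cong[OF e, of upper] arg_cong[OF e, of lower] by simp_all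
    define x where "x = induced E (pb1 Dg (upper d)) (pb2 Dg (upper d)) (upper u) (upper v)"
    define y where "y = induced C (pb1 Dk (lower d)) (pb2 Dk (lower d)) (lower u) (lower v)"
    have x: "x \<in> Arr E" "Dom E x = Dom E (upper u)" "Cod E x = Dom E (pb1 Dg (upper d))"
      "pb1 Dg (upper d) \<bullet> x = upper u" "pb2 Dg (upper d) \<bullet> x = upper v"
      unfolding x_def
      by (subst E.induced[OF Dg.pullback[of "upper d"] _ _ _ _ _ e'(1)]; simp add: d u' v')+
    have y: "y \<in> Arr C" "Dom C y = Dom C (lower u)" "Cod C y = Dom C (pb1 Dk (lower d))"
      "pb1 Dk (lower d) \<odot> y = lower u" "pb2 Dk (lower d) \<odot> y = lower v"
      unfolding y_def
      by (subst C.induced[OF Dk.pullback[of "lower d"] _ _ _ _ _ e'(2)]; simp add: d u' v')+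
    \<comment> \<open>The square condition for \<open>x\<close> and \<open>y\<close> is an equation
      of maps into the image of a pullback, so it is checked on both projections, where it becomes
      the square of \<open>u\<close> or of \<open>v\<close>.\<close>
    have "gmap (gpb d) \<bullet> x = farr F y \<bullet> gmap (src v)"
    proof (rule E.pullback_unique[OF F_pullback[OF d(6,8)]])
      have "farr F (pb1 Dk (lower d)) \<bullet> gmap (gpb d) \<bullet> x = (gmap \<beta> \<bullet> pb1 Dg (upper d)) \<bullet> x"
        using d p x by (simp add: E.comp_assoc_eq[OF p(4)])
      also have "\<dots> = farr F (lower u) \<bullet> gmap (src v)"
        using d u' x by simp
      also have "\<dots> = farr F (pb1 Dk (lower d)) \<bullet> farr F y \<bullet> gmap (src v)"
        by (subst E.comp_assoc_eq[where k = "farr F (pb1 Dk (lower d))" and l = "farr F (lower u)"])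
          (simp_all add: d u' v' y flip: F_simps(5))
      finally show "farr F (pb1 Dk (lower d)) \<bullet> gmap (gpb d) \<bullet> x = \<dots>" .
      have "farr F (pb2 Dk (lower d)) \<bullet> gmap (gpb d) \<bullet> x = (gmap (src d) \<bullet> pb2 Dg (upper d)) \<bullet> x"
        using d p x by (simp add: E.comp_assoc_eq[OF p(5)])
      also have "\<dots> = farr F (lower v) \<bullet> gmap (src v)"
        using d v' x by simp
      also have "\<dots> = farr F (pb2 Dk (lower d)) \<bullet> farr F y \<bullet> gmap (src v)"
        by (subst E.comp_assoc_eq[where k = "farr F (pb2 Dk (lower d))" and l = "farr F (lower v)"])
          (simp_all add: d u' v' y flip: F_simps(5))
      finally show "farr F (pb2 Dk (lower d)) \<bullet> gmap (gpb d) \<bullet> x = \<dots>" .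
    qed (use d p x y u' v' in simp_all)
    then have t: "GlAr (src u) (gpb d) x y \<in> Arr (Gl C E F)"
      using p x y u' v' uv by (simp add: Arr_Gl)
    have uv_eq: "GlAr (src u) \<beta> (upper u) (lower u) = u" "GlAr (src u) (src d) (upper v) (lower v) = v"
      using uv by (cases u; cases v; simp)+
    show ?thesis
    proof (rule ex1I[of _ "GlAr (src u) (gpb d) x y"])
      show "GlAr (src u) (gpb d) x y \<in> hom (Gl C E F) (src u) (gpb d) \<and>
        gpb1 d \<cdot>\<^bsub>Gl C E F\<^esub> GlAr (src u) (gpb d) x y = u \<and> gpb2 d \<cdot>\<^bsub>Gl C E F\<^esub> GlAr (src u) (gpb d) x y = v"
        using t x y uv_eq by (simp add: hom_def)
      fix t assume a: "t \<in> hom (Gl C E F) (src u) (gpb d) \<and> gpb1 d \<cdot>\<^bsub>Gl C E F\<^esub> t = u \<and> gpb2 d \<cdot>\<^bsub>Gl C E F\<^esub> t = v"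
      then have t': "t \<in> Arr (Gl C E F)" "src t = src u" "tgt t = gpb d"
        by (auto simp: hom_def)
      note ta = Gl_arrD[OF t'(1), unfolded t']
      have c: "pb1 Dg (upper d) \<bullet> upper t = upper u" "pb2 Dg (upper d) \<bullet> upper t = upper v"
        "pb1 Dk (lower d) \<odot> lower t = lower u" "pb2 Dk (lower d) \<odot> lower t = lower v"
        using a by auto
      have "x = upper t"
        unfolding x_def using ta c p d by (intro E.induced_eqI[OF Dg.pullback]) auto
      moreover have "y = lower t"
        unfolding y_def using ta c p d by (intro C.induced_eqI[OF Dk.pullback]) auto
      ultimately show "t = GlAr (src u) (gpb d) x y"
        using t' by (cases t) simp
    qed
  qed
  then have "\<forall>u \<in> Arr (Gl C E F). \<forall>v \<in> Arr (Gl C E F). src u = src v \<and> tgt u = \<beta> \<and> tgt v = src d \<and>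
      m \<cdot>\<^bsub>Gl C E F\<^esub> u = d \<cdot>\<^bsub>Gl C E F\<^esub> v \<longrightarrow>
      (\<exists>!t. t \<in> hom (Gl C E F) (src u) (gpb d) \<and> gpb1 d \<cdot>\<^bsub>Gl C E F\<^esub> t = u \<and> gpb2 d \<cdot>\<^bsub>Gl C E F\<^esub> t = v)"
    by blast
  then show ?thesis
    unfolding is_pullback_def using gpb_arr[OF assms] m_arr assms sq
    by (simp del: Gl_simps(4))
qed

text \<open>Packaging the projections as a choice of pullbacks makes the generic results on pullback
  functors available for \<open>Gl\<close>.\<close>

definition gpbs :: "('oC, 'mC, 'mE) glar pbs" where
  "gpbs = \<lparr>pb1 = gpb1, pb2 = gpb2\<rparr>"

lemma gpbs_simps [simp]: "pb1 gpbs = gpb1" "pb2 gpbs = gpb2"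
  by (simp_all add: gpbs_def)

sublocale G: pbs_along "Gl C E F" m gpbs
  by unfold_locales (simp add: pullbacks_along_def gpb_pullback m_arr)

text \<open>The components of the pulled back map satisfy the projection equations that characterise
  the pulled back components.\<close>

lemma gpb_map:
  assumes "over (Gl C E F) d' d s" "tgt d = \<alpha>"
  shows "pb_map (Gl C E F) gpbs d' d s = GlAr (gpb d') (gpb d)
    (pb_map E Dg (upper d') (upper d) (upper s)) (pb_map C Dk (lower d') (lower d) (lower s))"
proof -
  have o: "d \<in> Arr (Gl C E F)" "d' \<in> Arr (Gl C E F)" "s \<in> Arr (Gl C E F)" "tgt d' = \<alpha>"
    using assms by (auto simp: over_Gl)
  note d = Gl_arrD[OF o(1), unfolded assms(2)] gpb[OF o(1) assms(2)]
  define t where "t = pb_map (Gl C E F) gpbs d' d s"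
  have t: "t \<in> Arr (Gl C E F)" "src t = gpb d'" "tgt t = gpb d"
    "gpb1 d \<cdot>\<^bsub>Gl C E F\<^esub> t = gpb1 d'" "gpb2 d \<cdot>\<^bsub>Gl C E F\<^esub> t = s \<cdot>\<^bsub>Gl C E F\<^esub> gpb2 d'"
    using G.pb_map[OF assms(1)] assms(2) unfolding t_def by auto
  note ta = Gl_arrD[OF t(1), unfolded t]
  have e: "pb1 Dg (upper d) \<bullet> upper t = pb1 Dg (upper d')"
    "pb2 Dg (upper d) \<bullet> upper t = upper s \<bullet> pb2 Dg (upper d')"
    "pb1 Dk (lower d) \<odot> lower t = pb1 Dk (lower d')"
    "pb2 Dk (lower d) \<odot> lower t = lower s \<odot> pb2 Dk (lower d')"
    using arg_cong[OF t(4), of upper] arg_cong[OF t(5), of upper]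
      arg_cong[OF t(4), of lower] arg_cong[OF t(5), of lower] by simp_all
  have "pb_map E Dg (upper d') (upper d) (upper s) = upper t"
    using d ta e by (intro Dg.pb_map_eqI) auto
  moreover have "pb_map C Dk (lower d') (lower d) (lower s) = lower t"
    using d ta e by (intro Dk.pb_map_eqI) auto
  ultimately show ?thesis
    using t unfolding t_def[symmetric] by (cases t) simp
qed

section \<open>The pullback defining the dependent product\<close>

text \<open>Both sides map into the image of a pullback along \<open>k\<close>, and their
  projections agree there.\<close>

lemma iso_natural:
  assumes "over C j j' v" "Cod C j' = base \<alpha>"
  shows "iso j' \<bullet> pb_map E Dl (farr F j) (farr F j') (farr F v) = farr F (pb_map C Dk j j' v) \<bullet> iso j"
proof -
  note v = overD[OF assms(1)] and j = C.over_cod[OF assms(1), unfolded assms(2)] assms(2)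
  have jk: "Cod C j' = Cod C k" "Cod E (farr F j') = Cod E (farr F k)"
    using v j by simp_all
  note n = Dk.pb_map[OF assms(1) jk(1)] and nl = Dl.pb_map[OF F_over[OF assms(1)] jk(2)]
  note i = iso[OF v(1) j(1)] and i' = iso[OF v(2) j(2)]
  have 1: "farr F (pb1 Dk j') \<bullet> farr F (pb_map C Dk j j' v) = farr F (pb1 Dk j)"
    "farr F (pb2 Dk j') \<bullet> farr F (pb_map C Dk j j' v) = farr F v \<bullet> farr F (pb2 Dk j)"
    using n v j by (simp_all flip: F_simps(5))
  note tl = E.comp_assoc_eq[OF i(4)] E.comp_assoc_eq[OF i(5)] E.comp_assoc_eq[OF i'(4)]
    E.comp_assoc_eq[OF i'(5)] E.comp_assoc_eq[OF 1(1)] E.comp_assoc_eq[OF 1(2)]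
  show ?thesis
    by (rule E.pullback_unique[OF F_pullback[OF v(2) j(2)]])
      (simp_all add: v j n nl i i' tl)
qed

section \<open>Transposing the two legs\<close>

abbreviation leg1 :: "('oC, 'mC, 'mE) glar \<Rightarrow> 'mE" where "leg1 \<equiv> gl_leg1 C E F m Dg Dk Dl A B"
abbreviation leg2 :: "('oC, 'mC, 'mE) glar \<Rightarrow> 'mE" where "leg2 \<equiv> gl_leg2 E F Dg B"
abbreviation Fev :: "'mC \<Rightarrow> 'mE" where "Fev \<equiv> F_ev C E F m Dk Dl"
abbreviation bev :: "'mC \<Rightarrow> 'mE" where "bev \<equiv> b_ev E F m Dg Dl A B"

text \<open>\<open>Fev h\<close> is defined as a transpose, so untransposing undoes it once the
  transposed map is known to lie over \<open>farr F h\<close>.\<close>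

lemma Fev:
  assumes "h \<in> Arr C" "Cod C h = base \<beta>"
  shows "over E (farr F (Dk.\<Pi> h)) (Dl.\<Pi> (farr F h)) (Fev h)"
    "Dl.untransp (farr F (Dk.\<Pi> h)) (farr F h) (Fev h)
      = farr F (sarr (ev C k Dk h)) \<bullet> iso (Dk.\<Pi> h)"
proof -
  have p: "Dk.\<Pi> h \<in> Arr C" "Cod C (Dk.\<Pi> h) = base \<alpha>" using assms by simp_all
  note i = iso[OF p]
  have o: "over C (pb1 Dk (Dk.\<Pi> h)) h (sarr (ev C k Dk h))"
    using assms by (intro Dk.ev_over) simp_all
  have 1: "farr F h \<bullet> farr F (sarr (ev C k Dk h)) = farr F (pb1 Dk (Dk.\<Pi> h))"
    using overD[OF o] by (simp flip: F_simps(5))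
  have "over E (pb1 Dl (farr F (Dk.\<Pi> h))) (farr F h) (farr F (sarr (ev C k Dk h)) \<bullet> iso (Dk.\<Pi> h))"
    unfolding over_def by (simp add: E.comp_assoc_eq[OF 1] overD[OF o] i p assms)
  note Dl.transp_over(1)[OF this] Dl.untransp_transp[OF this]
  then show "over E (farr F (Dk.\<Pi> h)) (Dl.\<Pi> (farr F h)) (Fev h)"
    "Dl.untransp (farr F (Dk.\<Pi> h)) (farr F h) (Fev h)
      = farr F (sarr (ev C k Dk h)) \<bullet> iso (Dk.\<Pi> h)"
    using p by (simp_all add: F_ev_def Let_def)
qed

text \<open>Up to \<open>iso\<close>, \<open>F\<close> commutes with transposition. Naturality of
  \<open>untransp\<close> produces a pullback of \<open>farr F v\<close>, \<open>iso_natural\<close>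
  moves it inside \<open>F\<close>, and there it combines with the counit into the transpose of
  \<open>v\<close>.\<close>

lemma Fev_untransp:
  assumes "over C j (Dk.\<Pi> h) v" "h \<in> Arr C" "Cod C h = base \<beta>"
  shows "over E (farr F j) (Dl.\<Pi> (farr F h)) (Fev h \<bullet> farr F v)"
    "Dl.untransp (farr F j) (farr F h) (Fev h \<bullet> farr F v) = farr F (Dk.untransp j h v) \<bullet> iso j"
proof -
  have h: "farr F h \<in> Arr E" "Cod E (farr F h) = Dom E (farr F k)" "Cod C h = Dom C k"
    "Cod C (Dk.\<Pi> h) = base \<alpha>" "Cod C (Dk.\<Pi> h) = Cod C k"
    using assms by simp_all
  have j: "j \<in> Arr C" "Cod C j = base \<alpha>"
    using overD[OF assms(1)] C.over_cod[OF assms(1)] h by simp_all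
  note f = Fev[OF assms(2,3)] and v = F_over[OF assms(1)]
  show "over E (farr F j) (Dl.\<Pi> (farr F h)) (Fev h \<bullet> farr F v)"
    by (rule E.over_comp[OF v f(1)])
  note n = Dk.pb_map[OF assms(1) h(5)]
  have o: "over C (pb1 Dk (Dk.\<Pi> h)) h (sarr (ev C k Dk h))"
    using assms by (intro Dk.ev_over) simp_all
  have hk: "Cod E (farr F (Dk.\<Pi> h)) = Cod E (farr F k)" using assms by simp
  have "Dl.untransp (farr F j) (farr F h) (Fev h \<bullet> farr F v)
      = (farr F (sarr (ev C k Dk h)) \<bullet> iso (Dk.\<Pi> h))
        \<bullet> pb_map E Dl (farr F j) (farr F (Dk.\<Pi> h)) (farr F v)"
    by (simp add: Dl.untransp_comp[OF f(1) v h(1,2)] f(2))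
  also have "\<dots> = farr F (sarr (ev C k Dk h)) \<bullet> farr F (pb_map C Dk j (Dk.\<Pi> h) v) \<bullet> iso j"
    using overD[OF o] iso[of "Dk.\<Pi> h"] assms h Dl.pb_map[OF v hk]
    by (simp add: iso_natural[OF assms(1) h(4)])
  also have "\<dots> = farr F (Dk.untransp j h v) \<bullet> iso j"
    using Dk.ev_pb_map[OF assms(1,2) h(3), symmetric] overD[OF o] n iso[OF j] by simp
  finally show "Dl.untransp (farr F j) (farr F h) (Fev h \<bullet> farr F v)
    = farr F (Dk.untransp j h v) \<bullet> iso j" .
qed

text \<open>The component at \<open>F z\<close> of the transpose of
  \<open>bev h \<bullet> s\<close>. As \<open>bev h\<close> is itself a transpose, only the pullback
  of \<open>s\<close> along \<open>g\<close> is added, and \<open>pb2 B\<close> turns the pullback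
  of the counit along \<beta> into the counit itself.\<close>

lemma bev:
  assumes "h \<in> Arr C" "Cod C h = base \<beta>" "over E i (pb1 A (Dl.\<Pi> (farr F h))) s"
  shows "over E (pb1 A (Dl.\<Pi> (farr F h))) (Dg.\<Pi> (pb1 B (farr F h))) (bev h)"
    "pb2 B (farr F h) \<bullet> Dg.untransp i (pb1 B (farr F h)) (bev h \<bullet> s)
      = sarr (ev E (farr F k) Dl (farr F h)) \<bullet>
        induced E (pb1 Dl (Dl.\<Pi> (farr F h))) (pb2 Dl (Dl.\<Pi> (farr F h)))
         (gmap \<beta> \<bullet> pb1 Dg i) (pb2 A (Dl.\<Pi> (farr F h)) \<bullet> s \<bullet> pb2 Dg i)"
proof -
  define \<pi> where "\<pi> = Dl.\<Pi> (farr F h)"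
  define d where "d = pb1 A \<pi>"
  have Fh: "farr F h \<in> Arr E" "Cod E (farr F h) = fobj F (base \<beta>)"
    "Cod E (farr F h) = Dom E (farr F k)" "Cod E (farr F h) = Cod E (gmap \<beta>)"
    using assms by simp_all
  have \<pi>: "\<pi> \<in> Arr E" "Cod E \<pi> = fobj F (base \<alpha>)" "Cod E \<pi> = Cod E (farr F k)"
    unfolding \<pi>_def using assms by simp_all
  have d: "d \<in> Arr E" "Cod E d = Dom E (gmap \<alpha>)" "Cod E d = Cod E g"
    "pb2 A \<pi> \<in> Arr E" "Dom E (pb2 A \<pi>) = Dom E d" "Cod E (pb2 A \<pi>) = Dom E \<pi>"
    unfolding d_def using \<pi> by simp_all
  have s: "over E i d s" using assms by (simp add: d_def \<pi>_def)
  note s' = overD[OF s] E.over_cod[OF s]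
  define p where "p = pb1 Dl \<pi>"
  have p: "p \<in> Arr E" "Cod E p = fobj F (base \<beta>)" "Cod E p = Cod E (gmap \<beta>)"
    "pb2 Dl \<pi> \<in> Arr E" "Dom E (pb2 Dl \<pi>) = Dom E p" "Cod E (pb2 Dl \<pi>) = Dom E \<pi>"
    unfolding p_def using \<pi> by simp_all
  note pbl = Dl.pullback[OF \<pi>(1,3), folded p_def] and pbb = B.pullback[OF p(1,3)]
  have ev: "over E p (farr F h) (sarr (ev E (farr F k) Dl (farr F h)))"
    unfolding p_def \<pi>_def by (rule Dl.ev_over[OF Fh(1,3)])
  note ev' = overD[OF ev]
  have B: "pb1 B p \<in> Arr E" "pb2 B p \<in> Arr E" "Dom E (pb2 B p) = Dom E (pb1 B p)"
    "Cod E (pb1 B p) = Dom E (gmap \<beta>)" "Cod E (pb2 B p) = Dom E p"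
    using p by simp_all
  note bm = B.pb_map[OF ev Fh(4)]

  have sq: "farr F k \<bullet> (gmap \<beta> \<bullet> pb1 Dg d) = \<pi> \<bullet> (pb2 A \<pi> \<bullet> pb2 Dg d)"
  proof -
    have "farr F k \<bullet> (gmap \<beta> \<bullet> pb1 Dg d) = gmap \<alpha> \<bullet> g \<bullet> pb1 Dg d"
      by (subst E.comp_assoc_eq[OF m_square]) (simp_all add: d)
    also have "\<dots> = (gmap \<alpha> \<bullet> pb1 A \<pi>) \<bullet> pb2 Dg d"
      unfolding d_def[symmetric] using d by (simp add: Dg.pb_square)
    also have "\<dots> = \<pi> \<bullet> (pb2 A \<pi> \<bullet> pb2 Dg d)"
      using \<pi> d by (simp add: A.pb_square)
    finally show ?thesis .
  qed
  \<comment> \<open>\<open>q\<close> is the inner map of \<open>assoc\<close> in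
    \<open>b_ev\<close>, and \<open>r\<close> below is \<open>assoc\<close> itself.\<close>
  define q where "q = induced E p (pb2 Dl \<pi>) (gmap \<beta> \<bullet> pb1 Dg d) (pb2 A \<pi> \<bullet> pb2 Dg d)"
  have q: "q \<in> Arr E" "Dom E q = Dom E (pb1 Dg d)" "Cod E q = Dom E p"
    "p \<bullet> q = gmap \<beta> \<bullet> pb1 Dg d" "pb2 Dl \<pi> \<bullet> q = pb2 A \<pi> \<bullet> pb2 Dg d"
    unfolding q_def by (subst E.induced[OF pbl _ _ _ _ _ sq]; simp add: d p \<pi>)+
  have sq2: "gmap \<beta> \<bullet> pb1 Dg d = p \<bullet> q" by (simp add: q)
  define r where "r = induced E (pb1 B p) (pb2 B p) (pb1 Dg d) q"
  have r: "r \<in> Arr E" "Dom E r = Dom E (pb1 Dg d)" "Cod E r = Dom E (pb1 B p)"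
    "pb1 B p \<bullet> r = pb1 Dg d" "pb2 B p \<bullet> r = q"
    unfolding r_def by (subst E.induced[OF pbb _ _ _ _ _ sq2]; simp add: d p q)+
  have bev: "bev h = Dg.transp d (pb1 B (farr F h)) (pb_map E B p (farr F h) (sarr (ev E (farr F k) Dl (farr F h))) \<bullet> r)"
  proof -
    have "ev E (farr F k) Dl (farr F h) = SlAr p (farr F h) (sarr (ev E (farr F k) Dl (farr F h)))"
      by (simp add: Dl.ev_eq[OF Fh(1,3)] p_def \<pi>_def)
    then have "sarr (farr (pullback_functor E B) (ev E (farr F k) Dl (farr F h)))
        = pb_map E B p (farr F h) (sarr (ev E (farr F k) Dl (farr F h)))"
      by (metis pullback_functor_simps(2) slar.sel(3))
    then show ?thesis
      by (simp add: b_ev_def Let_def r_def q_def flip: \<pi>_def d_def p_def)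
  qed
  have o: "over E (pb1 Dg d) (pb1 B (farr F h))
      (pb_map E B p (farr F h) (sarr (ev E (farr F k) Dl (farr F h))) \<bullet> r)"
    unfolding over_def by (simp add: E.comp_assoc_eq[OF bm(4)] bm r B d Fh)
  have o2: "over E d (Dg.\<Pi> (pb1 B (farr F h))) (bev h)"
    unfolding bev by (rule Dg.transp_over(1)[OF o d(1,3)])
  then show "over E (pb1 A (Dl.\<Pi> (farr F h))) (Dg.\<Pi> (pb1 B (farr F h))) (bev h)"
    by (simp add: d_def \<pi>_def)
  define M where "M = pb_map E Dg i d s"
  note M = Dg.pb_map[OF s d(3), folded M_def]
  have Bh: "pb1 B (farr F h) \<in> Arr E" "Cod E (pb1 B (farr F h)) = Dom E g"
    using Fh by simp_all
  \<comment> \<open>Precomposing with \<open>M\<close>, the pullback of \<open>s\<close> along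
    \<open>g\<close>, replaces the components of \<open>q\<close> by those over
    \<open>i\<close>.\<close>
  have qM: "induced E p (pb2 Dl \<pi>) (gmap \<beta> \<bullet> pb1 Dg i) (pb2 A \<pi> \<bullet> s \<bullet> pb2 Dg i) = q \<bullet> M"
    by (rule E.induced_eqI[OF pbl])
      (simp_all add: q M p s' E.comp_assoc_eq[OF q(4)] E.comp_assoc_eq[OF q(5)] d)
  have "pb2 B (farr F h) \<bullet> Dg.untransp i (pb1 B (farr F h)) (bev h \<bullet> s)
      = pb2 B (farr F h) \<bullet> (pb_map E B p (farr F h) (sarr (ev E (farr F k) Dl (farr F h))) \<bullet> r) \<bullet> M"
    unfolding Dg.untransp_comp[OF o2 s Bh] M_def by (simp only: bev Dg.untransp_transp[OF o d(1,3)])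
  also have "\<dots> = sarr (ev E (farr F k) Dl (farr F h)) \<bullet> pb2 B p \<bullet> r \<bullet> M"
    by (simp add: E.comp_assoc_eq[OF bm(5)] bm r B M Fh ev' p)
  also have "\<dots> = sarr (ev E (farr F k) Dl (farr F h)) \<bullet> q \<bullet> M"
    by (simp add: E.comp_assoc_eq[OF r(5)] r B M)
  finally show "pb2 B (farr F h) \<bullet> Dg.untransp i (pb1 B (farr F h)) (bev h \<bullet> s)
      = sarr (ev E (farr F k) Dl (farr F h)) \<bullet>
        induced E (pb1 Dl (Dl.\<Pi> (farr F h))) (pb2 Dl (Dl.\<Pi> (farr F h)))
         (gmap \<beta> \<bullet> pb1 Dg i) (pb2 A (Dl.\<Pi> (farr F h)) \<bullet> s \<bullet> pb2 Dg i)"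
    by (simp add: qM flip: \<pi>_def p_def)
qed

text \<open>The map with components \<open>i\<close> and \<open>F v \<circ> \<delta>\<close>, forced
  on any map into \<open>p\<close> that lies over \<open>v\<close>.\<close>

definition fst_comp :: "('oC, 'mC, 'mE) glar \<Rightarrow> ('oC, 'mC, 'mE) glar \<Rightarrow> 'mC \<Rightarrow> 'mE" where
  "fst_comp c d v = induced E (pb1 A (farr F (Dk.\<Pi> (lower c)))) (pb2 A (farr F (Dk.\<Pi> (lower c))))
     (upper d) (farr F v \<bullet> gmap (src d))"

lemma Pi_base:
  assumes "h \<in> Arr C" "Cod C h = base \<beta>"
  shows "farr F (Dk.\<Pi> h) \<in> Arr E" "Cod E (farr F (Dk.\<Pi> h)) = Cod E (gmap \<alpha>)"
    "Dl.\<Pi> (farr F h) \<in> Arr E" "Cod E (Dl.\<Pi> (farr F h)) = Cod E (gmap \<alpha>)"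
  using assms by simp_all

text \<open>The cone commutes because \<open>farr F v\<close> lies over
  \<open>farr F (lower d)\<close> and \<open>d\<close> satisfies its square in
  \<open>Gl\<close>.\<close>

lemma fst_comp:
  assumes "d \<in> Arr (Gl C E F)" "tgt d = \<alpha>" "h = lower c" "h \<in> Arr C" "Cod C h = base \<beta>"
    "over C (lower d) (Dk.\<Pi> h) v"
  shows "over E (upper d) (pb1 A (farr F (Dk.\<Pi> h))) (fst_comp c d v)"
    "pb2 A (farr F (Dk.\<Pi> h)) \<bullet> fst_comp c d v = farr F v \<bullet> gmap (src d)"
proof -
  note d = Gl_arrD[OF assms(1), unfolded assms(2)]
  note v = overD[OF F_over[OF assms(6)]] overD[OF assms(6)]
  note pi = Pi_base[OF assms(4,5)]
  have sq: "gmap \<alpha> \<bullet> upper d = farr F (Dk.\<Pi> h) \<bullet> (farr F v \<bullet> gmap (src d))"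
    by (subst E.comp_assoc_eq[OF v(6)]) (simp_all add: d v assms(4,5))
  note ind = E.induced[OF A.pullback[OF pi(1,2)] _ _ _ _ _ sq, folded fst_comp_def[of c, folded assms(3)]]
  show "over E (upper d) (pb1 A (farr F (Dk.\<Pi> h))) (fst_comp c d v)"
    unfolding over_def using d v pi assms(4,5) by (intro conjI; (subst ind)?; simp)
  show "pb2 A (farr F (Dk.\<Pi> h)) \<bullet> fst_comp c d v = farr F v \<bullet> gmap (src d)"
    using d v pi assms(4,5) by (subst ind; simp)
qed



lemma leg1_eq: "leg1 c = bev (lower c) \<bullet>
    pb_map E A (farr F (Dk.\<Pi> (lower c))) (Dl.\<Pi> (farr F (lower c))) (Fev (lower c))"
  by (simp add: gl_leg1_def)

lemma leg1_over:
  assumes "h = lower c" "h \<in> Arr C" "Cod C h = base \<beta>"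
  shows "over E (pb1 A (farr F (Dk.\<Pi> h))) (Dg.\<Pi> (pb1 B (farr F h))) (leg1 c)"
proof -
  have "over E (pb1 A (farr F (Dk.\<Pi> h))) (pb1 A (Dl.\<Pi> (farr F h)))
      (pb_map E A (farr F (Dk.\<Pi> h)) (Dl.\<Pi> (farr F h)) (Fev h))"
    using Fev(1)[OF assms(2,3)] Pi_base(4)[OF assms(2,3)] by (rule A.pb_map_over)
  from this bev(1)[OF assms(2,3) this] show ?thesis
    unfolding leg1_eq assms(1)[symmetric] by (rule E.over_comp)
qed

text \<open>\<open>leg2 c\<close> is the dependent product functor applied to the induced map
  \<open>r\<close>. By naturality, untransposing moves \<open>r\<close> outside, and
  \<open>r\<close> has component \<open>gmap (src c)\<close> at \<open>F z\<close>.\<close>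

lemma leg2:
  assumes "c \<in> Arr (Gl C E F)" "tgt c = \<beta>"
  shows "over E (Dg.\<Pi> (upper c)) (Dg.\<Pi> (pb1 B (farr F (lower c)))) (leg2 c)"
    "over E (upper d) (Dg.\<Pi> (upper c)) u \<Longrightarrow>
      over E (pb1 Dg (upper d)) (pb1 B (farr F (lower c)))
        (Dg.untransp (upper d) (pb1 B (farr F (lower c))) (leg2 c \<bullet> u))"
    "over E (upper d) (Dg.\<Pi> (upper c)) u \<Longrightarrow>
      pb2 B (farr F (lower c)) \<bullet> Dg.untransp (upper d) (pb1 B (farr F (lower c))) (leg2 c \<bullet> u)
        = gmap (src c) \<bullet> Dg.untransp (upper d) (upper c) u"
proof -
  note c = Gl_arrD[OF assms(1), unfolded assms(2)]
  have h: "farr F (lower c) \<in> Arr E" "Cod E (farr F (lower c)) = Cod E (gmap \<beta>)"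
    using c by simp_all
  define r where "r = induced E (pb1 B (farr F (lower c))) (pb2 B (farr F (lower c))) (upper c) (gmap (src c))"
  have r: "over E (upper c) (pb1 B (farr F (lower c))) r" "pb2 B (farr F (lower c)) \<bullet> r = gmap (src c)"
    unfolding r_def over_def using E.induced[OF B.pullback[OF h] _ _ _ _ _ c(9)] c(1-8) h by simp_all
  have B: "Cod E (pb1 B (farr F (lower c))) = Dom E g" "pb1 B (farr F (lower c)) \<in> Arr E"
    using h by simp_all
  have eq: "leg2 c = sarr (farr (DPi Dg) (SlAr (upper c) (pb1 B (farr F (lower c))) r))"
    by (simp add: gl_leg2_def Let_def r_def)
  show l: "over E (Dg.\<Pi> (upper c)) (Dg.\<Pi> (pb1 B (farr F (lower c)))) (leg2 c)"
    unfolding eq by (rule Dg.Pi_map_over(1)[OF r(1) B(1)])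
  assume u: "over E (upper d) (Dg.\<Pi> (upper c)) u"
  have c': "upper c \<in> Arr E" "Cod E (upper c) = Dom E g"
    using c by simp_all
  note o = Dg.untransp_over(1)[OF u c']
  show "over E (pb1 Dg (upper d)) (pb1 B (farr F (lower c)))
        (Dg.untransp (upper d) (pb1 B (farr F (lower c))) (leg2 c \<bullet> u))"
    by (rule Dg.untransp_over(1)[OF E.over_comp[OF u l] B(2,1)])
  show "pb2 B (farr F (lower c)) \<bullet> Dg.untransp (upper d) (pb1 B (farr F (lower c))) (leg2 c \<bullet> u)
        = gmap (src c) \<bullet> Dg.untransp (upper d) (upper c) u"
    unfolding eq Dg.untransp_Pi_map[OF u r(1) B(1)]
    by (rule E.comp_assoc_eq[OF r(2)]) (simp_all add: overD[OF o] overD[OF r(1)] h)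
qed

text \<open>The left side says that \<open>fst_comp c d v\<close> and \<open>u\<close> together
  factor through \<open>p\<close>; the right side is the square condition for the pair of
  transposes. Both directions of the bijection use this equivalence.\<close>

lemma legs_eq_iff:
  assumes c: "c \<in> Arr (Gl C E F)" "tgt c = \<beta>" and d: "d \<in> Arr (Gl C E F)" "tgt d = \<alpha>"
    and v: "over C (lower d) (Dk.\<Pi> (lower c)) v" and u: "over E (upper d) (Dg.\<Pi> (upper c)) u"
  shows "leg1 c \<bullet> fst_comp c d v = leg2 c \<bullet> u \<longleftrightarrow>
    gmap (src c) \<bullet> Dg.untransp (upper d) (upper c) u
      = farr F (Dk.untransp (lower d) (lower c) v) \<bullet> gmap (gpb d)"
proof -
  define h where "h = lower c"
  note c' = Gl_arrD[OF c(1), unfolded c(2), folded h_def] and d' = Gl_arrD[OF d(1), unfolded d(2)]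
  note v = v[folded h_def]
  note fc = fst_comp[OF d h_def c'(6,8) v]
  have B: "pb1 B (farr F h) \<in> Arr E" "Cod E (pb1 B (farr F h)) = Dom E g"
    and Bh: "farr F h \<in> Arr E" "Cod E (farr F h) = Cod E (gmap \<beta>)"
    and Fh: "Cod E (farr F h) = Dom E (farr F k)" and hk: "Cod C h = Dom C k"
    using c' by simp_all
  have o1: "over E (upper d) (Dg.\<Pi> (pb1 B (farr F h))) (leg1 c \<bullet> fst_comp c d v)"
    using fc(1) leg1_over[OF h_def c'(6,8)] by (rule E.over_comp)
  have o2: "over E (upper d) (Dg.\<Pi> (pb1 B (farr F h))) (leg2 c \<bullet> u)"
    using u leg2(1)[OF c, folded h_def] by (rule E.over_comp)
  define W where "W = Dg.untransp (upper d) (pb1 B (farr F h)) (leg1 c \<bullet> fst_comp c d v)"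
  define L where "L = Dg.untransp (upper d) (pb1 B (farr F h)) (leg2 c \<bullet> u)"
  have W: "over E (pb1 Dg (upper d)) (pb1 B (farr F h)) W"
    unfolding W_def by (rule Dg.untransp_over(1)[OF o1 B])
  have L: "over E (pb1 Dg (upper d)) (pb1 B (farr F h)) L"
    unfolding L_def by (rule Dg.untransp_over(1)[OF o2 B])
  have "leg1 c \<bullet> fst_comp c d v = leg2 c \<bullet> u \<longleftrightarrow> W = L"
    unfolding W_def L_def by (rule Dg.untransp_eq_iff[OF o1 o2 B, symmetric])
  \<comment> \<open>\<open>W\<close> and \<open>L\<close> both lie over
    \<open>pb1 Dg (upper d)\<close>, so their projections to \<open>b\<close> agree and only the
    component at \<open>F z\<close> matters.\<close>
  also have "\<dots> \<longleftrightarrow> pb2 B (farr F h) \<bullet> W = pb2 B (farr F h) \<bullet> L"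
    using E.pullback_unique[OF B.pullback[OF Bh], of W L] overD[OF W] overD[OF L] by auto
  also have "pb2 B (farr F h) \<bullet> L = gmap (src c) \<bullet> Dg.untransp (upper d) (upper c) u"
    unfolding L_def h_def by (rule leg2(3)[OF c u])
  also have "pb2 B (farr F h) \<bullet> W = farr F (Dk.untransp (lower d) h v) \<bullet> gmap (gpb d)"
  proof -
    define \<pi> where "\<pi> = Dl.\<Pi> (farr F h)"
    note pb = Pi_base[OF c'(6,8), folded \<pi>_def]
    have pbl: "Cod E \<pi> = Cod E (farr F k)" using pb by simp
    note fe = Fev(1)[OF c'(6,8), folded \<pi>_def]
    \<comment> \<open>The pullback of \<open>Fev h\<close> along \<alpha>, the first factor of
      \<open>leg1 c\<close>.\<close>
    define a where "a = pb_map E A (farr F (Dk.\<Pi> h)) \<pi> (Fev h)"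
    note a = A.pb_map[OF fe pb(4), folded a_def]
    have ao: "over E (pb1 A (farr F (Dk.\<Pi> h))) (pb1 A \<pi>) a"
      unfolding a_def by (rule A.pb_map_over[OF fe pb(4)])
    have s: "over E (upper d) (pb1 A \<pi>) (a \<bullet> fst_comp c d v)"
      by (rule E.over_comp[OF fc(1) ao])
    have assoc: "leg1 c \<bullet> fst_comp c d v = bev h \<bullet> (a \<bullet> fst_comp c d v)"
      unfolding leg1_eq h_def[symmetric] a_def[symmetric, unfolded \<pi>_def]
      using overD[OF bev(1)[OF c'(6,8) s[unfolded \<pi>_def]], folded \<pi>_def] overD[OF ao] overD[OF fc(1)] by simp
    note b = bev(2)[OF c'(6,8) s[unfolded \<pi>_def], folded \<pi>_def assoc, folded W_def]
    note fv = Fev_untransp[OF v c'(6,8), folded \<pi>_def]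
    note pm = Dl.pb_map[OF fv(1) pbl] and cm = cmp[OF d]
    note v' = overD[OF v] and fc' = overD[OF fc(1)]
    have e: "pb2 A \<pi> \<bullet> (a \<bullet> fst_comp c d v) = Fev h \<bullet> farr F v \<bullet> gmap (src d)"
      by (subst E.comp_assoc_eq[OF a(5)])
        (use a fc fc' overD[OF fe] pb in \<open>simp_all\<close>)
    \<comment> \<open>The induced map supplied by \<open>bev\<close> is the pullback of
      \<open>Fev h \<bullet> farr F v\<close> along \<open>farr F k\<close>, after
      \<open>cmp d\<close>. The counit can then be absorbed by \<open>ev_pb_map\<close>.\<close>
    have "induced E (pb1 Dl \<pi>) (pb2 Dl \<pi>) (gmap \<beta> \<bullet> pb1 Dg (upper d))
        (pb2 A \<pi> \<bullet> (a \<bullet> fst_comp c d v) \<bullet> pb2 Dg (upper d))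
      = pb_map E Dl (farr F (lower d)) \<pi> (Fev h \<bullet> farr F v) \<bullet> cmp d"
    proof (rule E.induced_eqI[OF Dl.pullback[OF pb(3) pbl]])
      have "pb2 A \<pi> \<bullet> (a \<bullet> fst_comp c d v) \<bullet> pb2 Dg (upper d)
          = (Fev h \<bullet> farr F v \<bullet> gmap (src d)) \<bullet> pb2 Dg (upper d)"
        by (rule E.comp_assoc_eq[OF e, THEN trans[rotated]])
          (use a fc fc' d' pb overD[OF ao] in simp_all)
      also have "\<dots> = (Fev h \<bullet> farr F v) \<bullet> gmap (src d) \<bullet> pb2 Dg (upper d)"
        using overD[OF fe] v' d' c' pb by simp
      also have "\<dots> = pb2 Dl \<pi> \<bullet> pb_map E Dl (farr F (lower d)) \<pi> (Fev h \<bullet> farr F v) \<bullet> cmp d"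
        using overD[OF fv(1)] pm cm d' pb pbl by (simp add: E.comp_assoc_eq[OF pm(5)])
      finally show "pb2 Dl \<pi> \<bullet> pb_map E Dl (farr F (lower d)) \<pi> (Fev h \<bullet> farr F v) \<bullet> cmp d
        = pb2 A \<pi> \<bullet> (a \<bullet> fst_comp c d v) \<bullet> pb2 Dg (upper d)" ..
      show "pb1 Dl \<pi> \<bullet> pb_map E Dl (farr F (lower d)) \<pi> (Fev h \<bullet> farr F v) \<bullet> cmp d
          = gmap \<beta> \<bullet> pb1 Dg (upper d)"
        using pm cm d' pb pbl by (simp add: E.comp_assoc_eq[OF pm(4)])
    qed (use pm cm in simp_all)
    then have "pb2 B (farr F h) \<bullet> W = sarr (ev E (farr F k) Dl (farr F h)) \<bullet>
        pb_map E Dl (farr F (lower d)) \<pi> (Fev h \<bullet> farr F v) \<bullet> cmp d"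
      using b overD[OF ao] fc' d' by simp
    also have "\<dots> = Dl.untransp (farr F (lower d)) (farr F h) (Fev h \<bullet> farr F v) \<bullet> cmp d"
    proof (rule E.comp_assoc_eq)
      show "sarr (ev E (farr F k) Dl (farr F h)) \<bullet>
        pb_map E Dl (farr F (lower d)) \<pi> (Fev h \<bullet> farr F v)
        = Dl.untransp (farr F (lower d)) (farr F h) (Fev h \<bullet> farr F v)"
        unfolding \<pi>_def by (rule Dl.ev_pb_map[OF fv(1)[unfolded \<pi>_def] Bh(1) Fh])
    qed (use pm cm overD[OF Dl.ev_over[OF Bh(1) Fh], folded \<pi>_def] in simp_all)
    \<comment> \<open>By \<open>Fev_untransp\<close>; the remaining composite of \<open>iso\<close>
      with \<open>cmp d\<close> is \<open>gmap (gpb d)\<close>.\<close>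
    also have "\<dots> = farr F (Dk.untransp (lower d) h v) \<bullet> iso (lower d) \<bullet> cmp d"
      unfolding fv(2)
      using overD[OF Dk.untransp_over(1)[OF v c'(6) hk]] iso[OF d'(6,8)] cm d' by simp
    finally show ?thesis
      by (simp add: gpb_eq)
  qed
  finally show ?thesis
    unfolding h_def by auto
qed

end

section \<open>Dependent products in the gluing category\<close>

locale gluing_dprods = gluing_map C E F g k \<alpha> \<beta> Dg Dl Dk A B m
  for C :: "('oC, 'mC) cat" and E :: "('oE, 'mE) cat" and F :: "('oC, 'mC, 'oE, 'mE) fctr"
    and g :: 'mE and k :: 'mC and \<alpha> \<beta> :: "('oC, 'mE) glob"
    and Dg Dl :: "'mE dprods" and Dk :: "'mC dprods" and A B :: "'mE pbs"
    and m :: "('oC, 'mC, 'mE) glar" +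
  fixes p1 p2 :: "('oC, 'mC, 'mE) glar \<Rightarrow> 'mE"
  assumes p_pullback: "c \<in> Arr (Gl C E F) \<Longrightarrow> tgt c = \<beta> \<Longrightarrow> is_pullback E (leg1 c) (leg2 c) (p1 c) (p2 c)"
begin

abbreviation gPi :: "('oC, 'mC, 'mE) glar \<Rightarrow> ('oC, 'mC, 'mE) glar" where
  "gPi \<equiv> gl_Pi C E F m Dk A p1"

definition gtransp :: "('oC, 'mC, 'mE) glar \<Rightarrow> ('oC, 'mC, 'mE) glar \<Rightarrow> ('oC, 'mC, 'mE) glar
    \<Rightarrow> ('oC, 'mC, 'mE) glar" where
  "gtransp d c t = GlAr (src d) (src (gPi c))
     (induced E (p1 c) (p2 c) (fst_comp c d (Dk.transp (lower d) (lower c) (lower t)))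
       (Dg.transp (upper d) (upper c) (upper t)))
     (Dk.transp (lower d) (lower c) (lower t))"

text \<open>Only the projection \<open>p2 c\<close> of the upper map enters: its other projection is
  determined by \<open>lower s\<close>.\<close>

definition guntransp :: "('oC, 'mC, 'mE) glar \<Rightarrow> ('oC, 'mC, 'mE) glar \<Rightarrow> ('oC, 'mC, 'mE) glar
    \<Rightarrow> ('oC, 'mC, 'mE) glar" where
  "guntransp d c s = GlAr (gpb d) (src c)
     (Dg.untransp (upper d) (upper c) (p2 c \<bullet> upper s))
     (Dk.untransp (lower d) (lower c) (lower s))"

lemma gPi_simps [simp]:
  "src (gPi c) = GlOb (pb2 A (farr F (Dk.\<Pi> (lower c))) \<bullet> p1 c) (Dom C (Dk.\<Pi> (lower c)))"
  "tgt (gPi c) = \<alpha>" "upper (gPi c) = pb1 A (farr F (Dk.\<Pi> (lower c))) \<bullet> p1 c"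
  "lower (gPi c) = Dk.\<Pi> (lower c)"
  by (simp_all add: gl_Pi_def Let_def)

lemma p_arr:
  assumes "c \<in> Arr (Gl C E F)" "tgt c = \<beta>"
  shows "p1 c \<in> Arr E" "p2 c \<in> Arr E" "Dom E (p2 c) = Dom E (p1 c)"
    "Cod E (p1 c) = Dom E (pb1 A (farr F (Dk.\<Pi> (lower c))))" "Cod E (p2 c) = Dom E (Dg.\<Pi> (upper c))"
    "leg1 c \<bullet> p1 c = leg2 c \<bullet> p2 c"
  using E.pullback_arr[OF p_pullback[OF assms]] overD[OF leg2(1)[OF assms]]
    overD[OF leg1_over[OF refl Gl_arrD(6)[OF assms(1)] Gl_arrD(8)[OF assms(1), unfolded assms(2)]]]
    p_pullback[OF assms] by (simp_all add: is_pullback_def)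

text \<open>Both legs are maps over \<open>a\<close>, so the structure map of \<open>p\<close> may
  be computed through either projection.\<close>

lemma p_sections:
  assumes "c \<in> Arr (Gl C E F)" "tgt c = \<beta>"
  shows "Dg.\<Pi> (upper c) \<bullet> p2 c = pb1 A (farr F (Dk.\<Pi> (lower c))) \<bullet> p1 c"
proof -
  note c = Gl_arrD[OF assms(1), unfolded assms(2)] and p = p_arr[OF assms]
  note l1 = leg1_over[OF refl c(6,8)] and l2 = leg2(1)[OF assms]
  have "Dg.\<Pi> (upper c) \<bullet> p2 c = Dg.\<Pi> (pb1 B (farr F (lower c))) \<bullet> leg2 c \<bullet> p2 c"
    using p by (simp add: E.over_comp_assoc[OF l2])
  also have "\<dots> = pb1 A (farr F (Dk.\<Pi> (lower c))) \<bullet> p1 c"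
    unfolding p(6)[symmetric] using p(1-5) by (simp add: E.over_comp_assoc[OF l1])
  finally show ?thesis .
qed

text \<open>The square condition is the pullback square along \<alpha>, precomposed with
  \<open>p1 c\<close>.\<close>

lemma gPi_arr:
  assumes "c \<in> Arr (Gl C E F)" "tgt c = \<beta>"
  shows "gPi c \<in> Arr (Gl C E F)"
proof -
  note c = Gl_arrD[OF assms(1), unfolded assms(2)] and p = p_arr[OF assms]
  note pb = Pi_base[OF c(6,8)]
  have "gmap \<alpha> \<bullet> (pb1 A (farr F (Dk.\<Pi> (lower c))) \<bullet> p1 c)
      = farr F (Dk.\<Pi> (lower c)) \<bullet> (pb2 A (farr F (Dk.\<Pi> (lower c))) \<bullet> p1 c)"
    using E.comp_assoc_eq[OF A.pb_square[OF pb(1,2)], of "p1 c"] p pb by simp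
  then show ?thesis
    using c p pb by (simp add: Arr_Gl is_glob_def[of C E F "GlOb x y" for x y])
qed

text \<open>The pullback square of \<open>p\<close>, precomposed with \<open>upper s\<close>, is the
  left side of \<open>legs_eq_iff\<close>; hence the two transposes form a map of
  \<open>Gl\<close>.\<close>

lemma guntransp:
  assumes c: "c \<in> Arr (Gl C E F)" "tgt c = \<beta>" and d: "d \<in> Arr (Gl C E F)" "tgt d = \<alpha>"
    and s: "over (Gl C E F) d (gPi c) s"
  shows "over (Gl C E F) (gpb1 d) c (guntransp d c s)" "gtransp d c (guntransp d c s) = s"
    "over E (upper d) (Dg.\<Pi> (upper c)) (p2 c \<bullet> upper s)"
    "over C (lower d) (Dk.\<Pi> (lower c)) (lower s)"
proof -
  note c' = Gl_arrD[OF c(1), unfolded c(2)] and d' = Gl_arrD[OF d(1), unfolded d(2)]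
  note p = p_arr[OF c]
  note pb = Pi_base[OF c'(6,8)]
  have s1: "s \<in> Arr (Gl C E F)" "src s = src d" "tgt s = src (gPi c)"
    "over E (upper d) (pb1 A (farr F (Dk.\<Pi> (lower c))) \<bullet> p1 c) (upper s)"
    "over C (lower d) (Dk.\<Pi> (lower c)) (lower s)"
    using s by (simp_all add: over_Gl)
  note v = s1(5)
  note s' = overD[OF s1(4)] overD[OF v]
  have sg: "(pb2 A (farr F (Dk.\<Pi> (lower c))) \<bullet> p1 c) \<bullet> upper s = farr F (lower s) \<bullet> gmap (src d)"
    using Gl_arrD(9)[OF s1(1)] by (simp add: s1)
  \<comment> \<open>The first projection is forced: its component at \<open>a\<close> comes from the
    triangle over \<open>d\<close>, the other one from the square of \<open>s\<close>.\<close>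
  have fst: "fst_comp c d (lower s) = p1 c \<bullet> upper s"
    unfolding fst_comp_def
    by (rule E.induced_eqI[OF A.pullback[OF pb(1,2)]]) (use s' p pb sg in simp_all)
  have u: "over E (upper d) (Dg.\<Pi> (upper c)) (p2 c \<bullet> upper s)"
    unfolding over_def using s' p pb c' d' E.comp_assoc_eq[OF p_sections[OF c], of "upper s"] by simp
  show "over E (upper d) (Dg.\<Pi> (upper c)) (p2 c \<bullet> upper s)"
    "over C (lower d) (Dk.\<Pi> (lower c)) (lower s)" by fact+
  have "leg1 c \<bullet> fst_comp c d (lower s) = leg2 c \<bullet> p2 c \<bullet> upper s"
    unfolding fst by (rule E.pullback_comp[OF p_pullback[OF c]]) (use s' p pb in simp_all)
  then have e: "gmap (src c) \<bullet> Dg.untransp (upper d) (upper c) (p2 c \<bullet> upper s)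
      = farr F (Dk.untransp (lower d) (lower c) (lower s)) \<bullet> gmap (gpb d)"
    by (simp add: legs_eq_iff[OF c d v u])
  have cg: "Cod E (upper c) = Dom E g" "Cod C (lower c) = Dom C k" using c' by simp_all
  note U = Dg.untransp_over[OF u c'(3) cg(1)] and V = Dk.untransp_over[OF v c'(6) cg(2)]
  have "guntransp d c s \<in> Arr (Gl C E F)"
    using gpb[OF d] overD[OF U(1)] overD[OF V(1)] c' e by (simp add: Arr_Gl guntransp_def)
  then show "over (Gl C E F) (gpb1 d) c (guntransp d c s)"
    using c gpb_arr[OF d] U(1) V(1) by (simp add: over_Gl guntransp_def)
  \<comment> \<open>\<open>upper s\<close> has the two required projections, so it is recovered by
    uniqueness.\<close>
  have "induced E (p1 c) (p2 c) (fst_comp c d (lower s)) (p2 c \<bullet> upper s) = upper s"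
    unfolding fst by (rule E.induced_eqI[OF p_pullback[OF c]]) (use s' p pb in simp_all)
  then show "gtransp d c (guntransp d c s) = s"
    using U(3) V(3) s1 by (cases s) (simp add: gtransp_def guntransp_def)
qed

text \<open>Here \<open>legs_eq_iff\<close> is read backwards: the square of \<open>t\<close> makes
  the two maps a cone over the legs, and the cone induces the map into \<open>p\<close>.\<close>

lemma gtransp:
  assumes c: "c \<in> Arr (Gl C E F)" "tgt c = \<beta>" and d: "d \<in> Arr (Gl C E F)" "tgt d = \<alpha>"
    and t: "over (Gl C E F) (gpb1 d) c t"
  shows "over (Gl C E F) d (gPi c) (gtransp d c t)" "guntransp d c (gtransp d c t) = t"
proof -
  note c' = Gl_arrD[OF c(1), unfolded c(2)] and d' = Gl_arrD[OF d(1), unfolded d(2)]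
  note p = p_arr[OF c]
  note pb = Pi_base[OF c'(6,8)]
  have t1: "t \<in> Arr (Gl C E F)" "src t = gpb d" "tgt t = src c"
    "over E (pb1 Dg (upper d)) (upper c) (upper t)"
    "over C (pb1 Dk (lower d)) (lower c) (lower t)"
    using t by (simp_all add: over_Gl)
  have dg: "Cod E (upper d) = Cod E g" "Cod C (lower d) = Cod C k" using d' by simp_all
  define u where "u = Dg.transp (upper d) (upper c) (upper t)"
  define v where "v = Dk.transp (lower d) (lower c) (lower t)"
  note u = Dg.transp_over(1)[OF t1(4) d'(3) dg(1), folded u_def]
    and uu = Dg.untransp_transp[OF t1(4) d'(3) dg(1), folded u_def]
  note v = Dk.transp_over(1)[OF t1(5) d'(6) dg(2), folded v_def]
    and vv = Dk.untransp_transp[OF t1(5) d'(6) dg(2), folded v_def]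
  have e: "leg1 c \<bullet> fst_comp c d v = leg2 c \<bullet> u"
    unfolding legs_eq_iff[OF c d v u] uu vv using Gl_arrD(9)[OF t1(1)] by (simp add: t1)
  note fc = fst_comp[OF d refl c'(6,8) v]
  define w where "w = induced E (p1 c) (p2 c) (fst_comp c d v) u"
  have w: "w \<in> Arr E" "Dom E w = Dom E (upper d)" "Cod E w = Dom E (p1 c)"
    "p1 c \<bullet> w = fst_comp c d v" "p2 c \<bullet> w = u"
    unfolding w_def
    by (subst E.induced[OF p_pullback[OF c] _ _ _ _ _ e];
        simp add: overD[OF u] overD[OF fc(1)] overD[OF leg2(1)[OF c]] overD[OF leg1_over[OF refl c'(6,8)]])+
  have T: "gtransp d c t = GlAr (src d) (src (gPi c)) w v"
    by (simp add: gtransp_def w_def u_def v_def)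
  have "over E (upper d) (pb1 A (farr F (Dk.\<Pi> (lower c))) \<bullet> p1 c) w"
    unfolding over_def using w p pb d' overD[OF fc(1)] by simp
  moreover have "(pb2 A (farr F (Dk.\<Pi> (lower c))) \<bullet> p1 c) \<bullet> w = farr F v \<bullet> gmap (src d)"
    using w p pb d' fc(2) by simp
  moreover from this have "GlAr (src d) (src (gPi c)) w v \<in> Arr (Gl C E F)"
    using Gl_arrD[OF gPi_arr[OF c]] w d' p pb overD[OF v] by (simp add: Arr_Gl)
  ultimately show "over (Gl C E F) d (gPi c) (gtransp d c t)"
    unfolding over_Gl T using d gPi_arr[OF c] v by simp
  show "guntransp d c (gtransp d c t) = t"
    unfolding T using t1 by (cases t) (simp add: guntransp_def w uu vv)
qed

text \<open>Naturality is easier in this direction, since \<open>guntransp\<close> involves no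
  induced map into \<open>p\<close>: it reduces to \<open>untransp_comp\<close> in each
  component.\<close>

lemma guntransp_comp:
  assumes c: "c \<in> Arr (Gl C E F)" "tgt c = \<beta>" and d: "d \<in> Arr (Gl C E F)" "tgt d = \<alpha>"
    and s: "over (Gl C E F) d (gPi c) s" and r: "over (Gl C E F) d' d r"
  shows "guntransp d' c (s \<cdot>\<^bsub>Gl C E F\<^esub> r)
    = guntransp d c s \<cdot>\<^bsub>Gl C E F\<^esub> pb_map (Gl C E F) gpbs d' d r"
proof -
  note c' = Gl_arrD[OF c(1), unfolded c(2)]
  have cg: "Cod E (upper c) = Dom E g" "Cod C (lower c) = Dom C k" using c' by simp_all
  note u = guntransp(3,4)[OF c d s]
  have r': "over E (upper d') (upper d) (upper r)" "over C (lower d') (lower d) (lower r)"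
    and s': "over E (upper d) (pb1 A (farr F (Dk.\<Pi> (lower c))) \<bullet> p1 c) (upper s)"
    using r s by (simp_all add: over_Gl)
  have "p2 c \<bullet> upper s \<bullet> upper r = (p2 c \<bullet> upper s) \<bullet> upper r"
    using overD[OF r'(1)] overD[OF s'] p_arr[OF c] Pi_base[OF c'(6,8)] by simp
  then show ?thesis
    unfolding gpb_map[OF r d(2)]
    by (simp add: guntransp_def Dg.untransp_comp[OF u(1) r'(1) c'(3) cg(1)]
        Dk.untransp_comp[OF u(2) r'(2) c'(6) cg(2)])
qed


text \<open>\<open>gtransp\<close> and \<open>guntransp\<close> are mutually inverse and natural in
  \<open>d\<close>, which is all that \<open>adjunction_from_representation\<close> asks for; the
  action of the dependent product on maps comes from there.\<close>

theorem gluing_dprods_powerful_via: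
  obtains D :: "('oC, 'mC, 'mE) glar dprods" where
    "powerful_via (Gl C E F) m D" "pb1 D = gpb1" "pb2 D = gpb2" "fobj (DPi D) = gPi"
    "\<And>c d t. Tr D d c t = SlAr d (gPi c) (gtransp d c (sarr t))"
proof -
  let ?A = "slice (Gl C E F) \<alpha>" and ?B = "slice (Gl C E F) \<beta>"
  define \<phi> where "\<phi> d c t = SlAr d (gPi c) (gtransp d c (sarr t))" for d c t
  let ?\<psi> = "\<lambda>d c s. SlAr (gpb1 d) c (guntransp d c (sarr s))"
  have bij: "bij_betw (\<phi> d c) (hom ?B (fobj (pullback_functor (Gl C E F) gpbs) d) c) (hom ?A d (gPi c))"
    if "d \<in> Obj ?A" "c \<in> Obj ?B" for d c
  proof (rule bij_betw_byWitness[where f' = "?\<psi> d c"])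
    have c: "c \<in> Arr (Gl C E F)" "tgt c = \<beta>" and d: "d \<in> Arr (Gl C E F)" "tgt d = \<alpha>"
      using that by simp_all
    show "\<forall>t\<in>hom ?B (fobj (pullback_functor (Gl C E F) gpbs) d) c. ?\<psi> d c (\<phi> d c t) = t"
      using gtransp(2)[OF c d] by (auto simp: Gl.hom_slice \<phi>_def)
    show "\<forall>s\<in>hom ?A d (gPi c). \<phi> d c (?\<psi> d c s) = s"
      using guntransp(2)[OF c d] by (auto simp: Gl.hom_slice \<phi>_def)
    show "\<phi> d c ` hom ?B (fobj (pullback_functor (Gl C E F) gpbs) d) c \<subseteq> hom ?A d (gPi c)"
      using gtransp(1)[OF c d] by (auto simp: Gl.hom_slice \<phi>_def)
    show "?\<psi> d c ` hom ?A d (gPi c) \<subseteq> hom ?B (fobj (pullback_functor (Gl C E F) gpbs) d) c"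
      using guntransp(1)[OF c d] c by (auto simp: Gl.hom_slice \<phi>_def)
  qed
  have nat: "\<phi> (Dom ?A s) c (f \<cdot>\<^bsub>?B\<^esub> farr (pullback_functor (Gl C E F) gpbs) s)
      = \<phi> (Cod ?A s) c f \<cdot>\<^bsub>?A\<^esub> s"
    if s: "s \<in> Arr ?A" and c: "c \<in> Obj ?B"
      and f: "f \<in> hom ?B (fobj (pullback_functor (Gl C E F) gpbs) (Cod ?A s)) c" for s c f
  proof -
    obtain d' d r where s_eq: "s = SlAr d' d r" by (cases s)
    have c': "c \<in> Arr (Gl C E F)" "tgt c = \<beta>" using c by simp_all
    have r: "over (Gl C E F) d' d r" and d: "d \<in> Arr (Gl C E F)" "tgt d = \<alpha>"
      using s overD(2)[of "Gl C E F" d' d r] by (simp_all add: s_eq Gl.Arr_slice)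
    have d': "d' \<in> Arr (Gl C E F)" "tgt d' = \<alpha>"
      using overD(1)[OF r] Gl.over_cod[OF r] d by simp_all
    obtain t where f_eq: "f = SlAr (gpb1 d) c t" and t: "over (Gl C E F) (gpb1 d) c t"
      using f by (auto simp: s_eq Gl.hom_slice)
    note T = gtransp[OF c' d t]
    \<comment> \<open>Naturality of \<open>gtransp\<close> is deduced from that of its inverse, by
      writing the left side as the transpose of an untransposed composite.\<close>
    have "gtransp d' c (t \<cdot>\<^bsub>Gl C E F\<^esub> pb_map (Gl C E F) gpbs d' d r)
        = gtransp d' c (guntransp d' c (gtransp d c t \<cdot>\<^bsub>Gl C E F\<^esub> r))"
      unfolding guntransp_comp[OF c' d T(1) r] T(2) ..
    also have "\<dots> = gtransp d c t \<cdot>\<^bsub>Gl C E F\<^esub> r"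
      by (rule guntransp(2)[OF c' d' Gl.over_comp[OF r T(1)]])
    finally show ?thesis
      unfolding s_eq f_eq \<phi>_def by (simp del: Gl_simps(4))
  qed
  have L: "is_functor ?A ?B (pullback_functor (Gl C E F) gpbs)"
    using G.pullback_functor by simp
  have gPi_obj: "gPi c \<in> Obj ?A" if "c \<in> Obj ?B" for c
    using that gPi_arr by simp
  obtain R where R: "fobj R = gPi" "adjunction ?A ?B (pullback_functor (Gl C E F) gpbs) R \<phi>"
    using adjunction_from_representation[OF Gl.category_slice Gl.category_slice L gPi_obj bij nat]
    by blast
  define D :: "('oC, 'mC, 'mE) glar dprods" where "D = \<lparr>pb1 = gpb1, pb2 = gpb2, DPi = R, Tr = \<phi>\<rparr>"
  \<comment> \<open>The pullback functor reads only the two projections, which \<open>D\<close>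
    shares with \<open>gpbs\<close>.\<close>
  have "pullback_functor (Gl C E F) D = pullback_functor (Gl C E F) gpbs"
    by (simp add: pullback_functor_def D_def)
  then have "powerful_via (Gl C E F) m D"
    using R(2) G.pullbacks by (simp add: powerful_via_def pullbacks_along_def D_def)
  then show thesis
    by (rule that) (simp_all add: D_def R(1) \<phi>_def)
qed

end

text \<open>One witness \<open>D\<close> serves all clauses, so the formulas for pullbacks,
  dependent products, transposes and counit concern the same adjunction.\<close>

theorem theorem2p19:
  fixes C :: "('oC, 'mC) cat" and E :: "('oE, 'mE) cat" and F :: "('oC, 'mC, 'oE, 'mE) fctr"
    and \<beta> \<alpha> :: "('oC, 'mE) glob" and g :: 'mE and k :: 'mC and m :: "('oC, 'mC, 'mE) glar"
    and Dg Dl :: "'mE dprods" and Dk :: "'mC dprods" and A B :: "'mE pbs"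
    and p1 p2 :: "('oC, 'mC, 'mE) glar \<Rightarrow> 'mE"
  assumes "category C" and "category E" and "is_functor C E F" and "preserves_pullbacks C E F"
    and m: "m = GlAr \<beta> \<alpha> g k" "m \<in> Arr (Gl C E F)"
    and "powerful_via E g Dg" and "powerful_via C k Dk" and "powerful_via E (farr F k) Dl"
    and "pullbacks_along E (gmap \<alpha>) A" and "pullbacks_along E (gmap \<beta>) B"
    and "\<And>c. c \<in> Obj (slice (Gl C E F) \<beta>) \<Longrightarrow>
      is_pullback E (gl_leg1 C E F m Dg Dk Dl A B c) (gl_leg2 E F Dg B c) (p1 c) (p2 c)"
  shows "powerful (Gl C E F) m \<and>
    (\<exists>D. powerful_via (Gl C E F) m D \<and>
      (\<forall>d \<in> Obj (slice (Gl C E F) \<alpha>).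
        pb1 D d = gl_pb1 C E F m Dg Dk Dl d \<and> pb2 D d = gl_pb2 C E F m Dg Dk Dl d) \<and>
      (\<forall>c \<in> Obj (slice (Gl C E F) \<beta>). fobj (DPi D) c = gl_Pi C E F m Dk A p1 c) \<and>
      (\<forall>\<delta> i j \<gamma> f h.
        GlAr \<delta> \<alpha> i j \<in> Obj (slice (Gl C E F) \<alpha>) \<and> GlAr \<gamma> \<beta> f h \<in> Obj (slice (Gl C E F) \<beta>) \<longrightarrow>
        (let d = GlAr \<delta> \<alpha> i j; c = GlAr \<gamma> \<beta> f h;
             \<pi>c = gl_Pi C E F m Dk A p1 c; \<pi>z = farr F (fobj (DPi Dk) h);
             bd = gl_pb1 C E F m Dg Dk Dl d
         in
          (\<forall>u v. SlAr d \<pi>c (GlAr \<delta> (src \<pi>c) u v) \<in> hom (slice (Gl C E F) \<alpha>) d \<pi>c \<longrightarrow>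
            inv_into (hom (slice (Gl C E F) \<beta>) bd c) (Tr D d c)
              (SlAr d \<pi>c (GlAr \<delta> (src \<pi>c) u v)) =
            SlAr bd c (GlAr (src bd) \<gamma>
              (adj_untransp E g Dg i f (p2 c \<cdot>\<^bsub>E\<^esub> u))
              (adj_untransp C k Dk j h v))) \<and>
          (\<forall>u v. SlAr bd c (GlAr (src bd) \<gamma> u v) \<in> hom (slice (Gl C E F) \<beta>) bd c \<longrightarrow>
            Tr D d c (SlAr bd c (GlAr (src bd) \<gamma> u v)) =
            SlAr d \<pi>c (GlAr \<delta> (src \<pi>c)
              (induced E (p1 c) (p2 c)
                (induced E (pb1 A \<pi>z) (pb2 A \<pi>z) i (farr F (adj_transp Dk j h v) \<cdot>\<^bsub>E\<^esub> gmap \<delta>))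
                (adj_transp Dg i f u))
              (adj_transp Dk j h v))))) \<and>
      (\<forall>c \<in> Obj (slice (Gl C E F) \<beta>).
        map_slar (farr Gl_proj) (ev (Gl C E F) m D c) = ev C k Dk (farr Gl_proj c)))"
proof -
  interpret gluing_dprods C E F g k \<alpha> \<beta> Dg Dl Dk A B m p1 p2
    by unfold_locales (use assms in \<open>simp_all\<close>)
  obtain D :: "('oC, 'mC, 'mE) glar dprods" where
    D: "powerful_via (Gl C E F) m D" "pb1 D = gpb1" "pb2 D = gpb2" "fobj (DPi D) = gPi"
    "\<And>c d t. Tr D d c t = SlAr d (gPi c) (gtransp d c (sarr t))"
    using gluing_dprods_powerful_via by blast
  interpret D: dprods_along "Gl C E F" m D
    by unfold_locales (rule D(1))
  \<comment> \<open>\<open>guntransp d c s\<close> is a preimage under \<open>Tr D d c\<close>,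
    which is injective on this hom-set.\<close>
  have inv: "inv_into (hom (slice (Gl C E F) \<beta>) (gpb1 d) c) (Tr D d c) (SlAr d (gPi c) s)
      = SlAr (gpb1 d) c (guntransp d c s)"
    if "d \<in> Obj (slice (Gl C E F) \<alpha>)" "c \<in> Obj (slice (Gl C E F) \<beta>)" "over (Gl C E F) d (gPi c) s"
    for d c s
  proof -
    have c: "c \<in> Arr (Gl C E F)" "tgt c = \<beta>" and d: "d \<in> Arr (Gl C E F)" "tgt d = \<alpha>"
      using that by simp_all
    note U = guntransp[OF c d that(3)]
    have "SlAr d (gPi c) s = Tr D d c (SlAr (gpb1 d) c (guntransp d c s))"
      by (simp add: D(5) U(2))
    then show ?thesis
      using D.Tr_bij[of d c] c d U(1) by (simp add: D(2,4) bij_betw_def)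
  qed
  have transposes: "let d = GlAr \<delta> \<alpha> i j; c = GlAr \<gamma> \<beta> f h;
         \<pi>c = gl_Pi C E F m Dk A p1 c; \<pi>z = farr F (fobj (DPi Dk) h);
         bd = gl_pb1 C E F m Dg Dk Dl d
     in
      (\<forall>u v. SlAr d \<pi>c (GlAr \<delta> (src \<pi>c) u v) \<in> hom (slice (Gl C E F) \<alpha>) d \<pi>c \<longrightarrow>
        inv_into (hom (slice (Gl C E F) \<beta>) bd c) (Tr D d c)
          (SlAr d \<pi>c (GlAr \<delta> (src \<pi>c) u v)) =
        SlAr bd c (GlAr (src bd) \<gamma>
          (adj_untransp E g Dg i f (p2 c \<cdot>\<^bsub>E\<^esub> u))
          (adj_untransp C k Dk j h v))) \<and>
      (\<forall>u v. SlAr bd c (GlAr (src bd) \<gamma> u v) \<in> hom (slice (Gl C E F) \<beta>) bd c \<longrightarrow>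
        Tr D d c (SlAr bd c (GlAr (src bd) \<gamma> u v)) =
        SlAr d \<pi>c (GlAr \<delta> (src \<pi>c)
          (induced E (p1 c) (p2 c)
            (induced E (pb1 A \<pi>z) (pb2 A \<pi>z) i (farr F (adj_transp Dk j h v) \<cdot>\<^bsub>E\<^esub> gmap \<delta>))
            (adj_transp Dg i f u))
          (adj_transp Dk j h v)))"
    if "GlAr \<delta> \<alpha> i j \<in> Obj (slice (Gl C E F) \<alpha>) \<and> GlAr \<gamma> \<beta> f h \<in> Obj (slice (Gl C E F) \<beta>)"
    for \<delta> i j \<gamma> f h
    unfolding Let_def
  proof (intro conjI allI impI)
    fix u v
    let ?d = "GlAr \<delta> \<alpha> i j" and ?c = "GlAr \<gamma> \<beta> f h"
    assume "SlAr ?d (gPi ?c) (GlAr \<delta> (src (gPi ?c)) u v) \<in> hom (slice (Gl C E F) \<alpha>) ?d (gPi ?c)"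
    then have "over (Gl C E F) ?d (gPi ?c) (GlAr \<delta> (src (gPi ?c)) u v)"
      by (simp only: Gl.hom_slice_SlAr)
    from inv[OF conjunct1[OF that] conjunct2[OF that] this]
    show "inv_into (hom (slice (Gl C E F) \<beta>) (gpb1 ?d) ?c) (Tr D ?d ?c)
          (SlAr ?d (gPi ?c) (GlAr \<delta> (src (gPi ?c)) u v)) =
        SlAr (gpb1 ?d) ?c (GlAr (src (gpb1 ?d)) \<gamma>
          (adj_untransp E g Dg i f (p2 ?c \<cdot>\<^bsub>E\<^esub> u)) (adj_untransp C k Dk j h v))"
      by (simp add: guntransp_def)
  next
    fix u v
    let ?d = "GlAr \<delta> \<alpha> i j" and ?c = "GlAr \<gamma> \<beta> f h" and ?\<pi>z = "farr F (fobj (DPi Dk) h)"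
    show "Tr D ?d ?c (SlAr (gpb1 ?d) ?c (GlAr (src (gpb1 ?d)) \<gamma> u v)) =
        SlAr ?d (gPi ?c) (GlAr \<delta> (src (gPi ?c))
          (induced E (p1 ?c) (p2 ?c)
            (induced E (pb1 A ?\<pi>z) (pb2 A ?\<pi>z) i (farr F (adj_transp Dk j h v) \<cdot>\<^bsub>E\<^esub> gmap \<delta>))
            (adj_transp Dg i f u))
          (adj_transp Dk j h v))"
      by (simp add: D(5) gtransp_def fst_comp_def)
  qed
  have counit: "map_slar (farr Gl_proj) (ev (Gl C E F) m D c) = ev C k Dk (farr Gl_proj c)"
    if "c \<in> Obj (slice (Gl C E F) \<beta>)" for c
  proof -
    have c: "c \<in> Arr (Gl C E F)" "tgt c = \<beta>" using that by simp_all
    note c' = Gl_arrD[OF c(1), unfolded c(2)]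
    have h: "Cod C (lower c) = Dom C k" using c' by simp
    have P: "gPi c \<in> Obj (slice (Gl C E F) \<alpha>)" using gPi_arr[OF c] by simp
    \<comment> \<open>The counit untransposes an identity. The lower part of that identity is again
      an identity, so the lower part of the result is the counit along \<open>k\<close> by
      \<open>Dk.ev_eq\<close>.\<close>
    have "ev (Gl C E F) m D c = SlAr (gpb1 (gPi c)) c (guntransp (gPi c) c (Id (Gl C E F) (src (gPi c))))"
      using inv[OF P that, of "Id (Gl C E F) (Dom (Gl C E F) (gPi c))"] Gl.over_id[of "gPi c"] P
      by (simp add: ev_def counit_def D(2,4) del: Gl_simps(3))
    then show ?thesis
      using c' by (simp add: Gl_proj_def guntransp_def Dk.ev_eq[OF c'(6) h])
  qed
  show ?thesis
  proof (intro conjI exI[of _ D])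
    show "powerful (Gl C E F) m" using D(1) by (auto simp: powerful_def)
  qed (use D(1-4) transposes counit in \<open>auto\<close>)
qed

end
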